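(* Let $\theta$ be an inner function with $\theta^*=\theta$ and $\theta_0=0$, and let $\phi,\psi\in L^\infty\cap Z_\theta$. Then $\mathcal{H}_\phi^\theta$ and $\mathcal{H}_\psi^\theta$ commute if and only if one of them is a scalar multiple of the other.
   Context: $\mathbb{T}$ is the unit circle with normalized Lebesgue measure, $L^2=L^2(\mathbb{T})$, $L^\infty=L^\infty(\mathbb{T})$. $H^2\subset L^2$ is the Hardy space (functions whose negative Fourier coefficients vanish), $H_0^2=zH^2$, $\overline{H_0^2}=L^2\ominus H^2$. $P:L^2\to H^2$ is the orthogonal projection and $Q=I-P$ is the orthogonal projection onto $\overline{H_0^2}$. The flip $J$ on $L^2$ is $(Jf)(z)=f(\bar z)$, $z\in\mathbb{T}$; $f^*(z)=\overline{f(\bar z)}$. For an inner function $\theta$ (bounded analytic on the disk, unimodular a.e. on $\mathbb{T}$), $\theta_0$ is its $0$-th Fourier coefficient, $K_\theta=H^2\ominus\theta H^2$ and $K_\theta^\perp=L^2\ominus K_\theta=\overline{H_0^2}\oplus\theta H^2$; $Q_\theta=Q+\theta P\bar\theta$ is the orthogonal projection of $L^2$ onto $K_\theta^\perp$. For $\phi\in L^\infty$ the dual truncated Hankel operator is $\mathcal{H}_\phi^\theta:K_\theta^\perp\to K_\theta^\perp$, $\mathcal{H}_\phi^\theta(h)=Q_\theta J(\phi h)$. Also $Z_\theta=\left\{\frac{dz+\tilde h}{1-\bar\theta_0\theta}:\tilde h\in J(K_\theta),\,d\in\mathbb{C}\right\}$. *)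

theory Defs
  imports "HOL-Complex_Analysis.Complex_Analysis" "HOL-Probability.Probability"
begin

text \<open>
  Elements of \<open>L\<^sup>2\<close> and \<open>L\<^sup>\<infinity>\<close> of the unit circle are represented by functions
  \<open>complex \<Rightarrow> complex\<close>, of which only the restriction to the circle matters. All function spaces
  below are closed under almost-everywhere modification, and equality of elements is
  \<open>circle_eq\<close>.
\<close>

definition circle :: "complex measure" where
  "circle = distr (uniform_measure lborel {0..2 * pi}) (restrict_space borel (sphere 0 1)) cis"

lemma cis_measurable_circle:
  "cis \<in> measurable (uniform_measure lborel {0..2 * pi}) (restrict_space borel (sphere 0 1))"
proof (rule measurable_restrict_space2)
  have "cis \<in> borel_measurable borel"
    by (intro borel_measurable_continuous_onI continuous_intros)
  then show "cis \<in> borel_measurable (uniform_measure lborel {0..2 * pi})"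
    by (simp cong: measurable_cong_sets)
qed auto

lemma space_circle: "space circle = sphere 0 1"
  by (simp add: circle_def space_restrict_space)

lemma prob_space_circle: "prob_space circle"
  unfolding circle_def
  by (intro prob_space.prob_space_distr prob_space_uniform_measure cis_measurable_circle) auto

definition circle_eq :: "(complex \<Rightarrow> complex) \<Rightarrow> (complex \<Rightarrow> complex) \<Rightarrow> bool" where
  "circle_eq f g \<longleftrightarrow> (AE z in circle. f z = g z)"

definition L2 :: "(complex \<Rightarrow> complex) set" where
  "L2 = {f \<in> borel_measurable circle. integrable circle (\<lambda>z. (norm (f z))\<^sup>2)}"

definition Linf :: "(complex \<Rightarrow> complex) set" where
  "Linf = {f \<in> borel_measurable circle. \<exists>C. AE z in circle. norm (f z) \<le> C}"

definition L2_inner :: "(complex \<Rightarrow> complex) \<Rightarrow> (complex \<Rightarrow> complex) \<Rightarrow> complex" where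
  "L2_inner f g = (\<integral>z. f z * cnj (g z) \<partial>circle)"

definition fourier_coeff :: "(complex \<Rightarrow> complex) \<Rightarrow> int \<Rightarrow> complex" where
  "fourier_coeff f n = L2_inner f (\<lambda>z. z powi n)"

definition H2 :: "(complex \<Rightarrow> complex) set" where
  "H2 = {f \<in> L2. \<forall>n<0. fourier_coeff f n = 0}"

definition ortho_minus ::
    "(complex \<Rightarrow> complex) set \<Rightarrow> (complex \<Rightarrow> complex) set \<Rightarrow> (complex \<Rightarrow> complex) set" where
  "ortho_minus A B = {f \<in> A. \<forall>g\<in>B. L2_inner f g = 0}"

text \<open>
  For a closed subspace \<open>S\<close> of \<open>L\<^sup>2\<close> and \<open>f\<close> in \<open>L\<^sup>2\<close>, the projection is determined up to
  \<open>circle_eq\<close>. The choice depends only on the class of \<open>f\<close>, because \<open>L2_inner\<close> does.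
\<close>

definition ortho_proj ::
    "(complex \<Rightarrow> complex) set \<Rightarrow> (complex \<Rightarrow> complex) \<Rightarrow> (complex \<Rightarrow> complex)" where
  "ortho_proj S f = (SOME g. g \<in> S \<and> (\<forall>s\<in>S. L2_inner (\<lambda>z. f z - g z) s = 0))"

definition P_proj :: "(complex \<Rightarrow> complex) \<Rightarrow> (complex \<Rightarrow> complex)" where
  "P_proj = ortho_proj H2"

definition Q_proj :: "(complex \<Rightarrow> complex) \<Rightarrow> (complex \<Rightarrow> complex)" where
  "Q_proj f = (\<lambda>z. f z - P_proj f z)"

definition flip :: "(complex \<Rightarrow> complex) \<Rightarrow> (complex \<Rightarrow> complex)" where
  "flip f = (\<lambda>z. f (cnj z))"

definition star :: "(complex \<Rightarrow> complex) \<Rightarrow> (complex \<Rightarrow> complex)" where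
  "star f = (\<lambda>z. cnj (f (cnj z)))"

text \<open>
  An inner function and its boundary function are a single function on the closed disk, whose
  values on the circle are almost everywhere the radial limits. Measurability does not follow
  from this since \<open>circle\<close> is not complete.
\<close>

definition inner_function :: "(complex \<Rightarrow> complex) \<Rightarrow> bool" where
  "inner_function \<theta> \<longleftrightarrow>
     \<theta> holomorphic_on ball 0 1 \<and> bounded (\<theta> ` ball 0 1) \<and>
     \<theta> \<in> borel_measurable circle \<and>
     (AE z in circle. ((\<lambda>r. \<theta> (of_real r * z)) \<longlongrightarrow> \<theta> z) (at_left 1)) \<and>
     (AE z in circle. norm (\<theta> z) = 1)"

definition K_space :: "(complex \<Rightarrow> complex) \<Rightarrow> (complex \<Rightarrow> complex) set" where
  "K_space \<theta> = ortho_minus H2 ((\<lambda>g z. \<theta> z * g z) ` H2)"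

definition K_perp :: "(complex \<Rightarrow> complex) \<Rightarrow> (complex \<Rightarrow> complex) set" where
  "K_perp \<theta> = ortho_minus L2 (K_space \<theta>)"

definition Q_theta :: "(complex \<Rightarrow> complex) \<Rightarrow> (complex \<Rightarrow> complex) \<Rightarrow> (complex \<Rightarrow> complex)" where
  "Q_theta \<theta> f = (\<lambda>z. Q_proj f z + \<theta> z * P_proj (\<lambda>w. cnj (\<theta> w) * f w) z)"

text \<open>The operator is meant to be applied to elements of \<open>K_perp \<theta>\<close> only.\<close>

definition dual_trunc_hankel ::
    "(complex \<Rightarrow> complex) \<Rightarrow> (complex \<Rightarrow> complex) \<Rightarrow> (complex \<Rightarrow> complex) \<Rightarrow> (complex \<Rightarrow> complex)" where
  "dual_trunc_hankel \<theta> \<phi> h = Q_theta \<theta> (flip (\<lambda>z. \<phi> z * h z))"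

definition op_eq_on ::
    "(complex \<Rightarrow> complex) set \<Rightarrow> ((complex \<Rightarrow> complex) \<Rightarrow> (complex \<Rightarrow> complex)) \<Rightarrow>
     ((complex \<Rightarrow> complex) \<Rightarrow> (complex \<Rightarrow> complex)) \<Rightarrow> bool" where
  "op_eq_on S A B \<longleftrightarrow> (\<forall>h\<in>S. circle_eq (A h) (B h))"

definition op_scale ::
    "complex \<Rightarrow> ((complex \<Rightarrow> complex) \<Rightarrow> (complex \<Rightarrow> complex)) \<Rightarrow>
     (complex \<Rightarrow> complex) \<Rightarrow> (complex \<Rightarrow> complex)" where
  "op_scale c A h = (\<lambda>z. c * A h z)"

definition Z_space :: "(complex \<Rightarrow> complex) \<Rightarrow> (complex \<Rightarrow> complex) set" where
  "Z_space \<theta> = {f \<in> borel_measurable circle. \<exists>d. \<exists>h \<in> flip ` K_space \<theta>.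
     circle_eq f (\<lambda>z. (d * z + h z) / (1 - cnj (fourier_coeff \<theta> 0) * \<theta> z))}"

end

theory Submission imports Defs "HOL-Real_Asymp.Real_Asymp" begin

text \<open>
  Put \<open>\<alpha> = cnj \<theta> * flip \<phi>\<close> and \<open>\<beta> = cnj \<theta> * flip \<psi>\<close>, and write \<open>A\<close> and \<open>B\<close> for the operators with symbols
  \<open>\<phi>\<close> and \<open>\<psi>\<close>. Membership of the symbols in \<open>Z_space \<theta>\<close>, together with the vanishing mean of \<open>\<theta>\<close>,
  implies that \<open>\<alpha>\<close> and \<open>\<beta>\<close> have only Fourier coefficients of negative index
  (\<open>fourier_coeff_twisted_symbol\<close>).

  For the forward direction it is enough to look at a single vector. If all coefficients of \<open>\<alpha>\<close> and
  \<open>\<beta>\<close> vanish, then \<open>\<phi> = 0\<close> by uniqueness of Fourier coefficients. Otherwise let \<open>- n\<close>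
  be the largest index at which one of the coefficients \<open>a\<close> of \<open>\<alpha>\<close> and \<open>b\<close> of \<open>\<beta>\<close> is nonzero. Then
  \<open>z powi (- n)\<close> lies in \<open>K_perp \<theta>\<close>, and \<open>A\<close> maps it to \<open>\<theta> P (z powi n * \<alpha>) = a * \<theta>\<close>, because \<open>z powi n * \<alpha>\<close> has
  no positive frequencies and constant term \<open>a\<close>; likewise \<open>B\<close> maps it to \<open>b * \<theta>\<close>
  (\<open>dual_trunc_hankel_powi\<close>). As \<open>\<theta>\<close> is symmetric, \<open>A\<close> maps \<open>\<theta>\<close> to \<open>\<alpha>\<close> and \<open>B\<close> maps it to \<open>\<beta>\<close>
  (\<open>dual_trunc_hankel_theta\<close>). So commutation at \<open>z powi (- n)\<close> reads \<open>b * \<alpha> = a * \<beta>\<close>; since \<open>\<theta>\<close> is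
  unimodular this is a nontrivial linear relation between \<open>\<phi>\<close> and \<open>\<psi>\<close>.

  The converse is formal once \<open>A\<close> and \<open>B\<close> are known to be homogeneous operators on \<open>K_perp \<theta>\<close> modulo null
  sets. This rests on the existence of the projection onto \<open>H\<^sup>2\<close>, that is on the Riesz--Fischer
  theorem, and, as does the forward direction, on the completeness of the Fourier system.
\<close>

section \<open>Integration on the circle\<close>

interpretation circle: prob_space circle
  by (rule prob_space_circle)

lemma sets_circle [measurable_cong]: "sets circle = sets (restrict_space borel (sphere 0 1))"
  by (simp add: circle_def)

lemma borel_measurable_circle_continuous:
  fixes f :: "complex \<Rightarrow> 'a::topological_space"
  assumes "continuous_on (sphere 0 1) f"
  shows "f \<in> borel_measurable circle"
  using borel_measurable_continuous_on_restrict[OF assms] measurable_cong_sets[OF sets_circle refl]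
  by blast

lemma uniform_measure_interval:
  "uniform_measure lborel {0..2 * pi} = density lborel (\<lambda>t. ennreal (indicator {0..2 * pi} t / (2 * pi)))"
  unfolding uniform_measure_def
proof (rule density_cong)
  show "AE t in lborel. indicator {0..2 * pi} t / emeasure lborel {0..2 * pi} =
          ennreal (indicator {0..2 * pi} t / (2 * pi))"
    by (auto simp: indicator_def divide_ennreal ennreal_1[symmetric] simp del: ennreal_1)
qed measurable

lemma lebesgue_integral_circle:
  fixes f :: "complex \<Rightarrow> complex"
  assumes cont: "continuous_on (sphere 0 1) f"
    and I: "((\<lambda>t. f (cis t)) has_integral I) {0..2 * pi}"
  shows "integral\<^sup>L circle f = I / (2 * pi)"
proof -
  have cont': "continuous_on {0..2 * pi} (\<lambda>t. f (cis t))"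
    by (rule continuous_on_compose2[OF cont]) (auto intro!: continuous_intros)
  have "(LBINT t:{0..2 * pi}. f (cis t)) = integral {0..2 * pi} (\<lambda>t. f (cis t))"
    by (intro set_borel_integral_eq_integral borel_integrable_atLeastAtMost') (rule cont')
  also have "\<dots> = I"
    using I by (rule integral_unique)
  finally have eq: "(LBINT t:{0..2 * pi}. f (cis t)) = I" .
  have fm: "f \<in> borel_measurable (restrict_space borel (sphere 0 1))"
    using borel_measurable_continuous_on_restrict[OF cont] .
  have meas: "(\<lambda>t. f (cis t)) \<in> borel_measurable lborel"
    using measurable_compose[OF cis_measurable_circle fm] by (simp cong: measurable_cong_sets)
  have "integral\<^sup>L circle f = integral\<^sup>L (uniform_measure lborel {0..2 * pi}) (\<lambda>t. f (cis t))"
    unfolding circle_def by (rule integral_distr[OF cis_measurable_circle fm])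
  also have "\<dots> = integral\<^sup>L lborel (\<lambda>t. (indicator {0..2 * pi} t / (2 * pi)) *\<^sub>R f (cis t))"
    unfolding uniform_measure_interval by (rule integral_density) (use meas in auto)
  also have "\<dots> = integral\<^sup>L lborel (\<lambda>t. (1 / (2 * pi)) *\<^sub>R (indicator {0..2 * pi} t *\<^sub>R f (cis t)))"
    by simp
  also have "\<dots> = (1 / (2 * pi)) *\<^sub>R I"
    using eq unfolding set_lebesgue_integral_def by (subst integral_scaleR_right) simp
  finally show ?thesis by (simp add: scaleR_conv_of_real field_simps)
qed

text \<open>
  This is Cauchy's theorem: with \<open>dz = \<i> z dt\<close> along the circle, the integral of \<open>f z * z ^ m\<close> against
  arc length is, up to a constant factor, a contour integral of the holomorphic function \<open>f z * z ^ (m - 1)\<close>.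
\<close>

lemma integral_circle_holomorphic:
  assumes "f holomorphic_on ball 0 R" "1 < R" "1 \<le> m"
  shows "(\<integral>z. f z * z ^ m \<partial>circle) = 0"
proof -
  define F where "F z = f z * z ^ (m - 1)" for z
  have hol: "F holomorphic_on ball 0 R"
    unfolding F_def by (intro holomorphic_intros assms)
  have "(F has_contour_integral 0) (circlepath 0 1)"
    using hol by (rule Cauchy_theorem_convex_simple) (use assms in auto)
  then have "((\<lambda>t. F (cis t) * \<i> * cis t) has_integral 0) {0..2 * pi}"
    unfolding circlepath_def by (subst (asm) has_contour_integral_part_circlepath_iff) auto
  from has_integral_mult_right[OF this, of "- \<i>"]
  have "((\<lambda>t. f (cis t) * cis t ^ m) has_integral 0) {0..2 * pi}"
    by (rule has_integral_eq[rotated, THEN iffD1[OF arg_cong[where f="\<lambda>x. (_ has_integral x) _"], rotated]])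
       (use assms(3) in \<open>auto simp: F_def power_eq_if mult_ac\<close>)
  moreover have "continuous_on (sphere 0 1) (\<lambda>z. f z * z ^ m)"
    by (intro continuous_intros continuous_on_subset[OF holomorphic_on_imp_continuous_on[OF assms(1)]])
       (use assms in auto)
  ultimately show ?thesis
    using lebesgue_integral_circle[of "\<lambda>z. f z * z ^ m" 0] by simp
qed

lemma measurable_cnj_circle [measurable]: "cnj \<in> measurable circle circle"
proof -
  have "cnj \<in> measurable circle (restrict_space borel (sphere 0 1))"
    by (rule measurable_restrict_space2)
       (auto simp: space_circle intro!: borel_measurable_circle_continuous continuous_intros)
  then show ?thesis
    using measurable_cong_sets[OF refl sets_circle] by blast
qed

text \<open>
  In the parameter \<open>t\<close> conjugation is the reflection \<open>t \<mapsto> 2 * pi - t\<close> of the interval, under which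
  Lebesgue measure is invariant. The flip therefore acts on almost-everywhere classes and on \<open>L\<^sup>2\<close>.
\<close>

lemma distr_cnj_circle: "distr circle circle cnj = circle"
proof (rule measure_eqI)
  fix A assume "A \<in> sets (distr circle circle cnj)"
  then have A: "A \<in> sets circle" by simp
  then have A': "A \<in> sets (restrict_space borel (sphere 0 1))" by (simp add: sets_circle)
  define B where "B = {0..2 * pi} \<inter> cis -` A"
  have cis: "cis -` S \<in> sets lborel" if "S \<in> sets (restrict_space borel (sphere 0 1))" for S
    using measurable_sets[OF cis_measurable_circle that] by simp
  have B: "B \<in> sets borel" unfolding B_def using cis[OF A'] by auto
  have em: "emeasure circle S = emeasure lborel ({0..2 * pi} \<inter> cis -` S) / emeasure lborel {0..2 * pi}"
    if "S \<in> sets circle" for S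
  proof -
    have S: "S \<in> sets (restrict_space borel (sphere 0 1))" using that by (simp add: sets_circle)
    show ?thesis
      unfolding circle_def emeasure_distr[OF cis_measurable_circle S]
      using cis[OF S] by (subst emeasure_uniform_measure) auto
  qed
  have cA: "cnj -` A \<inter> space circle \<in> sets circle"
    using measurable_sets[OF measurable_cnj_circle A] .
  have "emeasure lborel B = (\<integral>\<^sup>+t. indicator B t \<partial>lborel)"
    using B by simp
  also have "\<dots> = (\<integral>\<^sup>+t. indicator B (2 * pi + (-1) * t) \<partial>lborel)"
    using nn_integral_real_affine[of "indicator B" "-1" "2 * pi"] B by simp
  also have "\<dots> = (\<integral>\<^sup>+t. indicator ({0..2 * pi} \<inter> cis -` (cnj -` A \<inter> space circle)) t \<partial>lborel)"
  proof (intro nn_integral_cong)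
    fix t :: real
    have "cis (2 * pi + (-1) * t) = cnj (cis t)"
      by (simp add: complex_eq_iff)
    then show "indicator B (2 * pi + (-1) * t) =
        (indicator ({0..2 * pi} \<inter> cis -` (cnj -` A \<inter> space circle)) t :: ennreal)"
      by (auto simp: B_def indicator_def space_circle)
  qed
  also have "\<dots> = emeasure lborel ({0..2 * pi} \<inter> cis -` (cnj -` A \<inter> space circle))"
    using cis[of "cnj -` A \<inter> space circle"] cA by (simp add: sets_circle)
  finally show "emeasure (distr circle circle cnj) A = emeasure circle A"
    using em[OF A] em[OF cA] by (simp add: emeasure_distr[OF measurable_cnj_circle A] B_def)
qed simp

lemma AE_circle_cnj:
  assumes "AE z in circle. P z"
  shows "AE z in circle. P (cnj z)"
proof -
  have "AE z in distr circle circle cnj. P z"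
    using assms unfolding distr_cnj_circle .
  then show ?thesis by (rule AE_distrD[OF measurable_cnj_circle])
qed

lemma integrable_circle_cnj:
  fixes f :: "complex \<Rightarrow> 'a::{banach, second_countable_topology}"
  assumes "integrable circle f"
  shows "integrable circle (\<lambda>z. f (cnj z))"
  by (rule integrable_distr[OF measurable_cnj_circle]) (simp add: distr_cnj_circle assms)

lemma AE_circle_norm: "AE z in circle. norm z = 1"
  by (rule AE_I2) (simp add: space_circle)

section \<open>Square-integrable functions\<close>

lemma L2_measurable: "f \<in> L2 \<Longrightarrow> f \<in> borel_measurable circle"
  by (simp add: L2_def)

lemma integrable_mult_L2:
  assumes "f \<in> L2" "g \<in> L2"
  shows "integrable circle (\<lambda>z. f z * g z)"
proof (rule Bochner_Integration.integrable_bound)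
  show "integrable circle (\<lambda>z. (norm (f z))\<^sup>2 + (norm (g z))\<^sup>2)"
    using assms by (auto simp: L2_def)
  show "(\<lambda>z. f z * g z) \<in> borel_measurable circle"
    using assms[THEN L2_measurable] by measurable
  show "AE z in circle. norm (f z * g z) \<le> norm ((norm (f z))\<^sup>2 + (norm (g z))\<^sup>2)"
  proof (rule AE_I2)
    fix z
    have "2 * (norm (f z) * norm (g z)) \<le> (norm (f z))\<^sup>2 + (norm (g z))\<^sup>2"
      using sum_squares_bound[of "norm (f z)" "norm (g z)"] by simp
    then show "norm (f z * g z) \<le> norm ((norm (f z))\<^sup>2 + (norm (g z))\<^sup>2)"
      using mult_nonneg_nonneg[of "norm (f z)" "norm (g z)"] unfolding norm_mult real_norm_def
      by linarith
  qed
qed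

lemma L2_bounded_mult:
  assumes b: "b \<in> borel_measurable circle" "AE z in circle. norm (b z) \<le> C" and f: "f \<in> L2"
  shows "(\<lambda>z. b z * f z) \<in> L2"
proof -
  have m[measurable]: "f \<in> borel_measurable circle" "b \<in> borel_measurable circle"
    using b f by (auto simp: L2_def)
  have "integrable circle (\<lambda>z. (norm (b z * f z))\<^sup>2)"
  proof (rule Bochner_Integration.integrable_bound)
    show "integrable circle (\<lambda>z. C\<^sup>2 * (norm (f z))\<^sup>2)"
      using f by (auto simp: L2_def)
    show "AE z in circle. norm ((norm (b z * f z))\<^sup>2) \<le> norm (C\<^sup>2 * (norm (f z))\<^sup>2)"
      using b(2)
    proof eventually_elim
      case (elim z)
      have "(norm (b z))\<^sup>2 \<le> C\<^sup>2"
        using elim by (intro power_mono) auto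
      then show ?case
        by (simp add: norm_mult power_mult_distrib mult_right_mono)
    qed
  qed measurable
  then show ?thesis by (simp add: L2_def)
qed

lemma L2_cmult: "f \<in> L2 \<Longrightarrow> (\<lambda>z. c * f z) \<in> L2"
  by (rule L2_bounded_mult[where C="norm c"]) auto

lemma L2_add:
  assumes "f \<in> L2" "g \<in> L2"
  shows "(\<lambda>z. f z + g z) \<in> L2"
proof -
  have m[measurable]: "f \<in> borel_measurable circle" "g \<in> borel_measurable circle"
    using assms by (auto simp: L2_def)
  have "integrable circle (\<lambda>z. (norm (f z + g z))\<^sup>2)"
  proof (rule Bochner_Integration.integrable_bound)
    show "integrable circle (\<lambda>z. 2 * (norm (f z))\<^sup>2 + 2 * (norm (g z))\<^sup>2)"
      using assms by (auto simp: L2_def)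
    show "AE z in circle. norm ((norm (f z + g z))\<^sup>2) \<le> norm (2 * (norm (f z))\<^sup>2 + 2 * (norm (g z))\<^sup>2)"
    proof (rule AE_I2)
      fix z
      have "(norm (f z + g z))\<^sup>2 \<le> (norm (f z) + norm (g z))\<^sup>2"
        by (intro power_mono norm_triangle_ineq) auto
      also have "\<dots> \<le> 2 * (norm (f z))\<^sup>2 + 2 * (norm (g z))\<^sup>2"
        using sum_squares_bound[of "norm (f z)" "norm (g z)"] by (simp add: power2_sum)
      finally show "norm ((norm (f z + g z))\<^sup>2) \<le> norm (2 * (norm (f z))\<^sup>2 + 2 * (norm (g z))\<^sup>2)"
        by simp
    qed
  qed measurable
  then show ?thesis by (simp add: L2_def)
qed

lemma L2_diff: "f \<in> L2 \<Longrightarrow> g \<in> L2 \<Longrightarrow> (\<lambda>z. f z - g z) \<in> L2"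
  using L2_add[OF _ L2_cmult[of g "-1"], of f] by simp

lemma L2_zero: "(\<lambda>z. 0) \<in> L2"
  by (simp add: L2_def)

lemma L2_sum: "(\<And>i. i \<in> A \<Longrightarrow> f i \<in> L2) \<Longrightarrow> (\<lambda>z. \<Sum>i\<in>A. f i z) \<in> L2"
  by (induction A rule: infinite_finite_induct) (auto intro: L2_zero L2_add)

lemma L2_flip: "f \<in> L2 \<Longrightarrow> flip f \<in> L2"
  unfolding L2_def flip_def
  using integrable_circle_cnj[of "\<lambda>z. (norm (f z))\<^sup>2"] measurable_compose[OF measurable_cnj_circle]
  by auto

lemma L2_continuous:
  assumes "continuous_on (sphere 0 1) f"
  shows "f \<in> L2"
proof -
  have "compact (f ` sphere 0 1)"
    by (intro compact_continuous_image assms) auto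
  then obtain C where "\<And>z. z \<in> sphere 0 1 \<Longrightarrow> norm (f z) \<le> C"
    using compact_imp_bounded[of "f ` sphere 0 1"] unfolding bounded_iff by blast
  then have "AE z in circle. norm (f z) \<le> C"
    by (intro AE_I2) (auto simp: space_circle)
  from L2_bounded_mult[OF borel_measurable_circle_continuous[OF assms] this, of "\<lambda>_. 1"]
  show ?thesis by (simp add: L2_def)
qed

lemma L2_powi: "(\<lambda>z. z powi n) \<in> L2"
  by (rule L2_continuous) (auto intro!: continuous_intros)

lemma L2_power: "(\<lambda>z. z ^ n) \<in> L2"
  by (rule L2_continuous) (auto intro!: continuous_intros)

lemma L2_cnj: "f \<in> L2 \<Longrightarrow> (\<lambda>z. cnj (f z)) \<in> L2"
proof -
  have "cnj \<in> borel_measurable borel"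
    by (intro borel_measurable_continuous_onI continuous_intros)
  then show "f \<in> L2 \<Longrightarrow> (\<lambda>z. cnj (f z)) \<in> L2"
    unfolding L2_def by auto
qed

lemma L2_inner_integrable: "f \<in> L2 \<Longrightarrow> g \<in> L2 \<Longrightarrow> integrable circle (\<lambda>z. f z * cnj (g z))"
  by (intro integrable_mult_L2 L2_cnj)

lemma L2_inner_add_left:
  "f \<in> L2 \<Longrightarrow> g \<in> L2 \<Longrightarrow> h \<in> L2 \<Longrightarrow> L2_inner (\<lambda>z. f z + g z) h = L2_inner f h + L2_inner g h"
  by (simp add: L2_inner_def L2_inner_integrable ring_distribs)

lemma L2_inner_diff_left:
  "f \<in> L2 \<Longrightarrow> g \<in> L2 \<Longrightarrow> h \<in> L2 \<Longrightarrow> L2_inner (\<lambda>z. f z - g z) h = L2_inner f h - L2_inner g h"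
  by (simp add: L2_inner_def L2_inner_integrable ring_distribs)

lemma L2_inner_diff_right:
  "f \<in> L2 \<Longrightarrow> g \<in> L2 \<Longrightarrow> h \<in> L2 \<Longrightarrow> L2_inner h (\<lambda>z. f z - g z) = L2_inner h f - L2_inner h g"
  by (simp add: L2_inner_def L2_inner_integrable ring_distribs)

lemma L2_inner_cmult_left: "L2_inner (\<lambda>z. c * f z) g = c * L2_inner f g"
  by (simp add: L2_inner_def mult.assoc)

lemma L2_inner_cnj: "cnj (L2_inner f g) = L2_inner g f"
  unfolding L2_inner_def by (subst Bochner_Integration.integral_cnj[symmetric]) (simp add: mult.commute)

lemma L2_inner_sum_left:
  "(\<And>i. i \<in> A \<Longrightarrow> f i \<in> L2) \<Longrightarrow> g \<in> L2 \<Longrightarrow>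
     L2_inner (\<lambda>z. \<Sum>i\<in>A. f i z) g = (\<Sum>i\<in>A. L2_inner (f i) g)"
  by (induction A rule: infinite_finite_induct) (auto simp: L2_inner_add_left L2_sum, auto simp: L2_inner_def)

lemma L2_inner_cong_AE:
  assumes "AE z in circle. f z = f' z" "AE z in circle. g z = g' z"
    "f \<in> borel_measurable circle" "f' \<in> borel_measurable circle"
    "g \<in> borel_measurable circle" "g' \<in> borel_measurable circle"
  shows "L2_inner f g = L2_inner f' g'"
proof -
  have [measurable]: "cnj \<in> borel_measurable borel"
    by (intro borel_measurable_continuous_onI continuous_intros)
  note [measurable] = assms(3-6)
  show ?thesis unfolding L2_inner_def
  proof (rule integral_cong_AE)
    show "AE z in circle. f z * cnj (g z) = f' z * cnj (g' z)"
      using assms(1,2) by eventually_elim simp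
  qed measurable
qed

definition mean_square :: "(complex \<Rightarrow> complex) \<Rightarrow> real" where
  "mean_square f = (\<integral>z. (norm (f z))\<^sup>2 \<partial>circle)"

lemma L2_inner_self: "L2_inner f f = of_real (mean_square f)"
  unfolding L2_inner_def mean_square_def
  by (subst integral_complex_of_real[symmetric]) (simp add: complex_norm_square del: of_real_power)

lemma mean_square_nonneg: "mean_square f \<ge> 0"
  unfolding mean_square_def by simp

lemma mean_square_eq_0_iff:
  assumes "f \<in> L2"
  shows "mean_square f = 0 \<longleftrightarrow> (AE z in circle. f z = 0)"
  using assms unfolding mean_square_def L2_def
  by (subst integral_nonneg_eq_0_iff_AE) auto

lemma nn_integral_norm_square:
  "f \<in> L2 \<Longrightarrow> (\<integral>\<^sup>+z. ennreal ((norm (f z))\<^sup>2) \<partial>circle) = ennreal (mean_square f)"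
  unfolding mean_square_def L2_def by (subst nn_integral_eq_integral) auto

lemma integral_norm_mult_le:
  assumes "f \<in> L2" "g \<in> L2"
  shows "(\<integral>z. norm (f z) * norm (g z) \<partial>circle) \<le> sqrt (mean_square f * mean_square g)"
proof -
  note [measurable] = assms[THEN L2_measurable]
  have int: "integrable circle (\<lambda>z. norm (f z) * norm (g z))"
    using integrable_norm[OF integrable_mult_L2[OF assms]] by (simp add: norm_mult)
  let ?I = "\<integral>z. norm (f z) * norm (g z) \<partial>circle"
  have I: "?I \<ge> 0" by simp
  have "ennreal (?I\<^sup>2) = (\<integral>\<^sup>+z. ennreal (norm (f z)) * ennreal (norm (g z)) \<partial>circle)\<^sup>2"
    using int I by (simp add: nn_integral_eq_integral ennreal_power flip: ennreal_mult)
  also have "\<dots> \<le> (\<integral>\<^sup>+z. (ennreal (norm (f z)))\<^sup>2 \<partial>circle) * (\<integral>\<^sup>+z. (ennreal (norm (g z)))\<^sup>2 \<partial>circle)"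
    by (rule Cauchy_Schwarz_nn_integral) measurable
  also have "\<dots> = ennreal (mean_square f * mean_square g)"
    using nn_integral_norm_square[OF assms(1)] nn_integral_norm_square[OF assms(2)]
    by (simp add: ennreal_power ennreal_mult mean_square_nonneg)
  finally have "?I\<^sup>2 \<le> mean_square f * mean_square g"
    by (subst (asm) ennreal_le_iff) (simp_all add: mean_square_nonneg)
  then show ?thesis by (rule real_le_rsqrt)
qed

lemma norm_L2_inner_le:
  assumes "f \<in> L2" "g \<in> L2"
  shows "norm (L2_inner f g) \<le> sqrt (mean_square f * mean_square g)"
proof -
  have "norm (L2_inner f g) \<le> (\<integral>z. norm (f z * cnj (g z)) \<partial>circle)"
    unfolding L2_inner_def by (rule integral_norm_bound)
  also have "\<dots> = (\<integral>z. norm (f z) * norm (g z) \<partial>circle)"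
    by (simp add: norm_mult)
  also have "\<dots> \<le> sqrt (mean_square f * mean_square g)"
    by (rule integral_norm_mult_le[OF assms])
  finally show ?thesis .
qed

lemma integral_norm_le_mean_square:
  assumes "f \<in> L2"
  shows "(\<integral>z. norm (f z) \<partial>circle) \<le> sqrt (mean_square f)"
proof -
  have "mean_square (\<lambda>_. 1) = 1"
    using circle.prob_space by (simp add: mean_square_def)
  with integral_norm_mult_le[OF assms, of "\<lambda>_. 1"] show ?thesis
    by (simp add: L2_def)
qed

section \<open>Fourier coefficients and Bessel's inequality\<close>

lemma cnj_powi_circle:
  assumes "norm z = 1"
  shows "cnj (z powi n) = z powi (- n)"
proof -
  have "cnj z = inverse z"
    using assms by (simp add: inverse_complex_def complex_eq_iff norm_complex_def)
  then show ?thesis by (simp add: power_int_minus power_int_inverse complex_cnj_power_int)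
qed

lemma integral_powi_circle: "(\<integral>z. z powi n \<partial>circle) = of_bool (n = 0)"
proof -
  have pos: "(\<integral>z. z powi k \<partial>circle) = 0" if "k > 0" for k
  proof -
    have "(\<integral>z. 1 * z ^ nat k \<partial>circle) = 0"
      by (rule integral_circle_holomorphic[of _ 2]) (use that in auto)
    then show ?thesis using that by (simp add: power_int_def)
  qed
  consider "n = 0" | "n > 0" | "n < 0" by linarith
  then show ?thesis
  proof cases
    case 1 then show ?thesis using circle.prob_space by simp
  next
    case 2 then show ?thesis using pos by simp
  next
    case 3
    have "(\<integral>z. z powi n \<partial>circle) = (\<integral>z. cnj (z powi (- n)) \<partial>circle)"
      by (rule Bochner_Integration.integral_cong) (auto simp: space_circle cnj_powi_circle simp del: complex_cnj_power_int)
    also have "\<dots> = cnj (\<integral>z. z powi (- n) \<partial>circle)"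
      by (rule Bochner_Integration.integral_cnj)
    finally show ?thesis using 3 pos by simp
  qed
qed

lemma fourier_coeff_powi_mult:
  "fourier_coeff (\<lambda>z. z powi m * f z) n = fourier_coeff f (n - m)"
  unfolding fourier_coeff_def L2_inner_def
proof (rule Bochner_Integration.integral_cong[OF refl])
  fix z assume "z \<in> space circle"
  then have z: "norm z = 1" "z \<noteq> 0" by (auto simp: space_circle)
  have "z powi m * z powi (- n) = z powi (- (n - m))"
    using z(2) by (simp flip: power_int_add)
  then show "z powi m * f z * cnj (z powi n) = f z * cnj (z powi (n - m))"
    using cnj_powi_circle[OF z(1)] by (simp add: mult_ac)
qed

lemma fourier_coeff_powi: "fourier_coeff (\<lambda>z. z powi m) n = of_bool (m = n)"
proof -
  have "fourier_coeff (\<lambda>z. z powi m) n = fourier_coeff (\<lambda>z. z powi (m - n) * 1) 0"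
    using fourier_coeff_powi_mult[of m "\<lambda>_. 1" n] fourier_coeff_powi_mult[of "m - n" "\<lambda>_. 1" 0]
    by simp
  also have "\<dots> = (\<integral>z. z powi (m - n) \<partial>circle)"
    by (simp add: fourier_coeff_def L2_inner_def)
  finally show ?thesis by (simp add: integral_powi_circle)
qed

lemma L2_inner_power: "L2_inner (\<lambda>z. z ^ m) (\<lambda>z. z ^ n) = of_bool (m = n)"
  using fourier_coeff_powi[of "int m" "int n"] by (simp add: fourier_coeff_def)

lemma fourier_coeff_nat: "fourier_coeff f (int n) = L2_inner f (\<lambda>z. z ^ n)"
  by (simp add: fourier_coeff_def)

lemma fourier_coeff_cong_AE:
  assumes "AE z in circle. f z = g z" "f \<in> borel_measurable circle" "g \<in> borel_measurable circle"
  shows "fourier_coeff f n = fourier_coeff g n"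
  unfolding fourier_coeff_def
  by (rule L2_inner_cong_AE) (use assms L2_powi L2_measurable in auto)

lemma fourier_coeff_diff:
  "f \<in> L2 \<Longrightarrow> g \<in> L2 \<Longrightarrow> fourier_coeff (\<lambda>z. f z - g z) n = fourier_coeff f n - fourier_coeff g n"
  unfolding fourier_coeff_def by (intro L2_inner_diff_left L2_powi)

lemma fourier_coeff_add:
  "f \<in> L2 \<Longrightarrow> g \<in> L2 \<Longrightarrow> fourier_coeff (\<lambda>z. f z + g z) n = fourier_coeff f n + fourier_coeff g n"
  unfolding fourier_coeff_def by (intro L2_inner_add_left L2_powi)

lemma fourier_coeff_cmult: "fourier_coeff (\<lambda>z. c * f z) n = c * fourier_coeff f n"
  unfolding fourier_coeff_def by (rule L2_inner_cmult_left)

lemma L2_power_sum: "(\<lambda>z. \<Sum>n\<in>A. c n * z ^ n) \<in> L2"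
  by (intro L2_sum L2_cmult L2_power)

lemma mean_square_power_sum:
  assumes "finite A"
  shows "mean_square (\<lambda>z. \<Sum>n\<in>A. c n * z ^ n) = (\<Sum>n\<in>A. (norm (c n))\<^sup>2)"
proof -
  let ?S = "\<lambda>z. \<Sum>n\<in>A. c n * z ^ n"
  have coeff: "L2_inner ?S (\<lambda>z. z ^ m) = c m" if "m \<in> A" for m
  proof -
    have "L2_inner ?S (\<lambda>z. z ^ m) = (\<Sum>n\<in>A. c n * of_bool (n = m))"
      by (subst L2_inner_sum_left) (auto simp: L2_cmult L2_power L2_inner_cmult_left L2_inner_power)
    also have "\<dots> = c m" using that assms by (simp add: if_distrib of_bool_def cong: if_cong)
    finally show ?thesis .
  qed
  have "of_real (mean_square ?S) = L2_inner ?S ?S"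
    by (rule L2_inner_self[symmetric])
  also have "\<dots> = (\<Sum>n\<in>A. c n * L2_inner (\<lambda>z. z ^ n) ?S)"
    by (subst L2_inner_sum_left) (auto simp: L2_cmult L2_power L2_inner_cmult_left L2_power_sum)
  also have "\<dots> = (\<Sum>n\<in>A. c n * cnj (c n))"
  proof (rule sum.cong[OF refl])
    fix n assume "n \<in> A"
    then have "L2_inner (\<lambda>z. z ^ n) ?S = cnj (c n)"
      using arg_cong[OF coeff, of n cnj] by (simp only: L2_inner_cnj)
    then show "c n * L2_inner (\<lambda>z. z ^ n) ?S = c n * cnj (c n)" by simp
  qed
  also have "\<dots> = of_real (\<Sum>n\<in>A. (norm (c n))\<^sup>2)"
    by (simp only: complex_norm_square of_real_sum)
  finally show ?thesis using of_real_eq_iff by blast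
qed

text \<open>
  The difference between the two sides is the squared norm of the remainder that is left after subtracting
  the partial Fourier sum from \<open>f\<close>.
\<close>

lemma bessel:
  assumes "f \<in> L2" "finite A"
  shows "(\<Sum>n\<in>A. (norm (fourier_coeff f (int n)))\<^sup>2) \<le> mean_square f"
proof -
  let ?c = "\<lambda>n. fourier_coeff f (int n)"
  let ?S = "\<lambda>z. \<Sum>n\<in>A. ?c n * z ^ n"
  have S: "?S \<in> L2" by (rule L2_power_sum)
  have Sf: "L2_inner ?S f = of_real (\<Sum>n\<in>A. (norm (?c n))\<^sup>2)"
  proof -
    have "L2_inner ?S f = (\<Sum>n\<in>A. ?c n * L2_inner (\<lambda>z. z ^ n) f)"
      by (subst L2_inner_sum_left) (auto simp: L2_cmult L2_power L2_inner_cmult_left assms)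
    also have "\<dots> = (\<Sum>n\<in>A. ?c n * cnj (?c n))"
      by (simp add: fourier_coeff_nat L2_inner_cnj)
    finally show ?thesis by (simp only: complex_norm_square of_real_sum)
  qed
  have SS: "L2_inner ?S ?S = of_real (\<Sum>n\<in>A. (norm (?c n))\<^sup>2)"
    by (simp only: L2_inner_self mean_square_power_sum[OF assms(2)])
  have fS: "L2_inner f ?S = of_real (\<Sum>n\<in>A. (norm (?c n))\<^sup>2)"
    using arg_cong[OF Sf, of cnj] by (simp only: L2_inner_cnj complex_cnj_complex_of_real)
  have "of_real (mean_square (\<lambda>z. f z - ?S z)) = L2_inner (\<lambda>z. f z - ?S z) (\<lambda>z. f z - ?S z)"
    by (rule L2_inner_self[symmetric])
  also have "\<dots> = L2_inner f f - L2_inner f ?S - (L2_inner ?S f - L2_inner ?S ?S)"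
    by (simp only: L2_inner_diff_left L2_inner_diff_right assms S L2_diff)
  also have "\<dots> = of_real (mean_square f - (\<Sum>n\<in>A. (norm (?c n))\<^sup>2))"
    unfolding Sf SS fS by (simp add: L2_inner_self)
  finally have "mean_square (\<lambda>z. f z - ?S z) = mean_square f - (\<Sum>n\<in>A. (norm (?c n))\<^sup>2)"
    using of_real_eq_iff by blast
  then show ?thesis using mean_square_nonneg[of "\<lambda>z. f z - ?S z"] by simp
qed

section \<open>Uniqueness of Fourier coefficients\<close>

lemma integrable_powi_mult:
  assumes "integrable circle f"
  shows "integrable circle (\<lambda>z. f z * z powi n)"
proof (rule Bochner_Integration.integrable_bound[OF assms])
  show "(\<lambda>z. f z * z powi n) \<in> borel_measurable circle"
    using assms L2_measurable[OF L2_powi] by measurable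
  show "AE z in circle. norm (f z * z powi n) \<le> norm (f z)"
    by (rule AE_I2) (auto simp: space_circle norm_mult norm_power_int)
qed

text \<open>
  Multiplication by a real polynomial in the coordinates preserves the property that all Fourier
  coefficients vanish: on the circle the real-linear functions are combinations of \<open>z\<close> and
  \<open>z powi (- 1)\<close>, and multiplication by these only shifts the coefficients. Stating this for all \<open>f\<close>
  at once lets the induction pass through products.
\<close>

lemma annihilator_real_polynomial:
  fixes f :: "complex \<Rightarrow> complex"
  assumes "real_polynomial_function p"
    and "integrable circle f" "\<And>n. (\<integral>z. f z * z powi n \<partial>circle) = 0"
  shows "integrable circle (\<lambda>z. of_real (p z) * f z) \<and>
         (\<forall>n. (\<integral>z. of_real (p z) * f z * z powi n \<partial>circle) = 0)"
  using assms
proof (induction p arbitrary: f rule: real_polynomial_function.induct)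
  case (linear h f)
  \<comment> \<open>The Wirtinger coefficients of the real-linear form \<open>h\<close>: \<open>h z = c * z + d * cnj z\<close>.\<close>
  define c where "c = (of_real (h 1) - \<i> * of_real (h \<i>)) / 2"
  define d where "d = (of_real (h 1) + \<i> * of_real (h \<i>)) / 2"
  have h: "of_real (h z) = c * z powi 1 + d * z powi (- 1)" if "z \<in> space circle" for z
  proof -
    have z: "norm z = 1" using that by (simp add: space_circle)
    have "h z = h (Re z *\<^sub>R 1 + Im z *\<^sub>R \<i>)"
      by (rule arg_cong[of _ _ h]) (simp add: complex_eq_iff)
    also have "\<dots> = Re z * h 1 + Im z * h \<i>"
      using linear(1) by (simp add: linear_simps)
    finally have "h z = Re z * h 1 + Im z * h \<i>" .
    then have "of_real (h z) = c * z + d * cnj z"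
      by (simp add: c_def d_def complex_eq_iff field_simps)
    moreover have "z powi (- 1) = cnj z"
      using cnj_powi_circle[OF z, of 1] by (simp only: power_int_1_right)
    ultimately show ?thesis
      by (simp only: power_int_1_right)
  qed
  have I: "integrable circle (\<lambda>z. c * (f z * z powi m) + d * (f z * z powi k))" for m k
    by (intro Bochner_Integration.integrable_add integrable_mult_right integrable_powi_mult linear)
  have eq: "of_real (h z) * f z * z powi n = c * (f z * z powi (n + 1)) + d * (f z * z powi (n - 1))"
    if "z \<in> space circle" for z n
  proof -
    have "z \<noteq> 0" using that by (auto simp: space_circle)
    then have pw: "z powi (n + 1) = z powi n * z powi 1" "z powi (n - 1) = z powi n * z powi (- 1)"
      using power_int_add[of z n 1] power_int_add[of z n "- 1"] by simp_all
    show ?thesis unfolding h[OF that] pw by (simp only: ring_distribs mult_ac)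
  qed
  have "integrable circle (\<lambda>z. of_real (h z) * f z)"
    using I[of 1 "-1"]
    by (rule iffD1[OF Bochner_Integration.integrable_cong[OF refl], rotated])
       (use eq[of _ 0] in simp)
  moreover have "(\<integral>z. of_real (h z) * f z * z powi n \<partial>circle) = 0" for n
  proof -
    have "(\<integral>z. of_real (h z) * f z * z powi n \<partial>circle) =
        (\<integral>z. c * (f z * z powi (n + 1)) + d * (f z * z powi (n - 1)) \<partial>circle)"
      by (intro Bochner_Integration.integral_cong eq refl)
    also have "\<dots> = 0"
      by (subst Bochner_Integration.integral_add)
         (auto intro!: integrable_mult_right integrable_powi_mult linear simp: linear)
    finally show ?thesis .
  qed
  ultimately show ?case by blast
next
  case (const c f)
  then show ?case by (simp add: mult.assoc)
next
  case (add p q f)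
  note p = add.IH(1)[OF add.prems] and q = add.IH(2)[OF add.prems]
  have "integrable circle (\<lambda>z. of_real (p z) * f z * z powi n)"
    "integrable circle (\<lambda>z. of_real (q z) * f z * z powi n)" for n
    using p q by (auto intro!: integrable_powi_mult)
  then show ?case using p q by (simp add: ring_distribs)
next
  case (mult p q f)
  note q = mult.IH(2)[OF mult.prems]
  have "integrable circle (\<lambda>z. of_real (p z) * (of_real (q z) * f z)) \<and>
     (\<forall>n. (\<integral>z. of_real (p z) * (of_real (q z) * f z) * z powi n \<partial>circle) = 0)"
    by (rule mult.IH(1)) (use q in auto)
  then show ?case by (simp add: mult.assoc)
qed

text \<open>
  Real polynomials are uniformly dense in the continuous functions on the circle (Stone--Weierstrass).
\<close>

lemma annihilator_continuous:
  fixes f :: "complex \<Rightarrow> complex" and g :: "complex \<Rightarrow> real"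
  assumes f: "integrable circle f" "\<And>n. (\<integral>z. f z * z powi n \<partial>circle) = 0"
    and g: "continuous_on (sphere 0 1) g"
  shows "(\<integral>z. of_real (g z) * f z \<partial>circle) = 0"
proof -
  have gm: "g \<in> borel_measurable circle"
    by (rule borel_measurable_circle_continuous[OF g])
  have "norm (\<integral>z. of_real (g z) * f z \<partial>circle) \<le> e * (\<integral>z. norm (f z) \<partial>circle)" if "e > 0" for e
  proof -
    obtain p where p: "real_polynomial_function p" "\<And>z. z \<in> sphere 0 1 \<Longrightarrow> \<bar>g z - p z\<bar> < e"
      using Stone_Weierstrass_real_polynomial_function[OF compact_sphere g \<open>e > 0\<close>] by blast
    note pf = annihilator_real_polynomial[OF p(1) f]
    have small: "norm (of_real (g z - p z) * f z) \<le> e * norm (f z)" if "z \<in> space circle" for z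
      using p(2)[of z] that unfolding norm_mult norm_of_real
      by (intro mult_right_mono) (auto simp: space_circle)
    have pm: "p \<in> borel_measurable circle"
      using p(1) by (intro borel_measurable_circle_continuous continuous_on_polymonial_function)
        (simp add: real_polynomial_function_eq)
    have int: "integrable circle (\<lambda>z. of_real (g z - p z) * f z)"
    proof (rule Bochner_Integration.integrable_bound)
      show "integrable circle (\<lambda>z. e * norm (f z))"
        using f by auto
      show "(\<lambda>z. of_real (g z - p z) * f z) \<in> borel_measurable circle"
        using gm pm f by measurable
      show "AE z in circle. norm (of_real (g z - p z) * f z) \<le> norm (e * norm (f z))"
        using small \<open>e > 0\<close> by (intro AE_I2) (auto simp: abs_mult)
    qed
    have "(\<integral>z. of_real (g z) * f z \<partial>circle) =
        (\<integral>z. of_real (g z - p z) * f z + of_real (p z) * f z \<partial>circle)"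
      by (simp add: ring_distribs)
    also have "\<dots> = (\<integral>z. of_real (g z - p z) * f z \<partial>circle)"
      using pf[THEN conjunct2, rule_format, of 0] pf int by (subst Bochner_Integration.integral_add) auto
    finally have "norm (\<integral>z. of_real (g z) * f z \<partial>circle) \<le>
        (\<integral>z. norm (of_real (g z - p z) * f z) \<partial>circle)"
      by (simp only: integral_norm_bound)
    also have "\<dots> \<le> (\<integral>z. e * norm (f z) \<partial>circle)"
      using int f by (intro integral_mono small integrable_norm) auto
    finally show ?thesis by simp
  qed
  note le = this
  define I where "I = (\<integral>z. norm (f z) \<partial>circle)"
  have I: "I \<ge> 0" by (simp add: I_def)
  have "norm (\<integral>z. of_real (g z) * f z \<partial>circle) \<le> 0"
  proof (rule field_le_epsilon)
    fix d :: real assume "d > 0"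
    have "norm (\<integral>z. of_real (g z) * f z \<partial>circle) \<le> d / (I + 1) * I"
      unfolding I_def by (rule le) (use I \<open>d > 0\<close> in \<open>simp add: I_def[symmetric]\<close>)
    also have "\<dots> \<le> d" using I \<open>d > 0\<close> by (simp add: field_simps)
    finally show "norm (\<integral>z. of_real (g z) * f z \<partial>circle) \<le> 0 + d" by simp
  qed
  then show ?thesis by simp
qed

text \<open>
  The indicator of a closed set is the pointwise limit of continuous functions with values in
  \<open>[0, 1]\<close>, so dominated convergence applies.
\<close>

lemma annihilator_closed:
  fixes f :: "complex \<Rightarrow> complex"
  assumes f: "integrable circle f" "\<And>n. (\<integral>z. f z * z powi n \<partial>circle) = 0"
    and C: "closed C" "C \<noteq> {}"
  shows "(\<integral>z. indicator C z *\<^sub>R f z \<partial>circle) = 0"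
proof -
  define g where "g k z = max 0 (1 - real k * infdist z C)" for k z
  have gc: "continuous_on S (g k)" for k S
    unfolding g_def by (intro continuous_intros)
  have lim: "(\<lambda>k. g k z) \<longlonglongrightarrow> indicator C z" for z
  proof (cases "z \<in> C")
    case True
    then show ?thesis by (simp add: g_def)
  next
    case False
    then have pos: "infdist z C > 0"
      using in_closed_iff_infdist_zero[OF C] infdist_nonneg[of z C] by force
    then obtain K :: nat where K: "1 < real K * infdist z C"
      using reals_Archimedean3 by blast
    have "eventually (\<lambda>k. g k z = 0) sequentially"
      using eventually_ge_at_top[of K]
    proof eventually_elim
      case (elim k)
      then have "real K * infdist z C \<le> real k * infdist z C"
        using pos by (intro mult_right_mono) auto
      then show ?case using K by (simp add: g_def)
    qed
    then show ?thesis using False by (simp add: tendsto_eventually)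
  qed
  have "(\<lambda>k. \<integral>z. of_real (g k z) * f z \<partial>circle) \<longlonglongrightarrow> (\<integral>z. indicator C z *\<^sub>R f z \<partial>circle)"
  proof (rule integral_dominated_convergence[where w="\<lambda>z. norm (f z)"])
    have [measurable]: "f \<in> borel_measurable circle" using f by auto
    have [measurable]: "g k \<in> borel_measurable circle" for k
      by (rule borel_measurable_circle_continuous[OF gc])
    show "(\<lambda>z. of_real (g k z) * f z) \<in> borel_measurable circle" for k
      by measurable
    have "(indicator C :: complex \<Rightarrow> real) \<in> borel_measurable circle"
      by (rule borel_measurable_LIMSEQ_real[OF lim]) (rule borel_measurable_circle_continuous[OF gc])
    then show "(\<lambda>z. indicator C z *\<^sub>R f z) \<in> borel_measurable circle"
      by (rule borel_measurable_scaleR) (use f in auto)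
    show "integrable circle (\<lambda>z. norm (f z))" using f by auto
    show "AE z in circle. (\<lambda>k. of_real (g k z) * f z) \<longlonglongrightarrow> indicator C z *\<^sub>R f z"
      unfolding scaleR_conv_of_real by (intro AE_I2 tendsto_intros lim)
    show "AE z in circle. norm (of_real (g k z) * f z) \<le> norm (f z)" for k
    proof (rule AE_I2)
      fix z
      have "\<bar>g k z\<bar> \<le> 1" by (simp add: g_def infdist_nonneg)
      then show "norm (of_real (g k z) * f z) \<le> norm (f z)"
        by (simp add: norm_mult mult_left_le_one_le)
    qed
  qed
  moreover have "(\<integral>z. of_real (g k z) * f z \<partial>circle) = 0" for k
    by (rule annihilator_continuous[OF f gc])
  ultimately show ?thesis by (simp add: LIMSEQ_const_iff)
qed

text \<open>
  Closed sets generate the Borel sets and are stable under intersection, so the integral of \<open>f\<close> vanishes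
  over every measurable set once it vanishes over the closed ones.
\<close>

theorem fourier_uniqueness:
  fixes f :: "complex \<Rightarrow> complex"
  assumes f: "integrable circle f" "\<And>n. (\<integral>z. f z * z powi n \<partial>circle) = 0"
  shows "AE z in circle. f z = 0"
proof (rule circle.density_zero[OF f(1)])
  have sets: "B \<inter> sphere 0 1 \<in> sets circle" if "B \<in> sets borel" for B
    using that by (auto simp: sets_circle sets_restrict_space)
  have int: "set_integrable circle A f" if "A \<in> sets circle" for A
    unfolding set_integrable_def using that f(1) by (rule integrable_mult_indicator)
  have full: "(LINT z:sphere 0 1|circle. f z) = 0"
    using set_integral_space[OF f(1)] f(2)[of 0] by (simp add: space_circle)
  have zero: "(LINT z:B \<inter> sphere 0 1|circle. f z) = 0" if "B \<in> sets borel" for B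
  proof -
    have "Int_stable (Collect closed :: complex set set)"
      by (auto simp: Int_stable_def)
    moreover have "Collect closed \<subseteq> Pow (UNIV :: complex set)" by simp
    moreover have "B \<in> sigma_sets UNIV (Collect closed)"
      using that by (simp add: borel_eq_closed)
    ultimately show ?thesis
    proof (induction rule: sigma_sets_induct_disjoint)
      case (basic C)
      show ?case
      proof (cases "C = {}")
        case False
        have "(LINT z:C \<inter> sphere 0 1|circle. f z) = (\<integral>z. indicator C z *\<^sub>R f z \<partial>circle)"
          unfolding set_lebesgue_integral_def
          by (rule Bochner_Integration.integral_cong) (auto simp: space_circle indicator_def)
        then show ?thesis using annihilator_closed[OF f _ False] basic by simp
      qed (simp add: set_lebesgue_integral_def)
    next
      case empty
      then show ?case by (simp add: set_lebesgue_integral_def)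
    next
      case (compl A)
      then have A: "A \<in> sets borel" by (simp add: borel_eq_closed)
      then have "UNIV - A \<in> sets borel" by auto
      have "(LINT z:sphere 0 1|circle. f z) =
          (LINT z:(A \<inter> sphere 0 1) \<union> ((UNIV - A) \<inter> sphere 0 1)|circle. f z)"
        by (rule arg_cong[where f="\<lambda>A. set_lebesgue_integral circle A f"]) auto
      also have "\<dots> = (LINT z:A \<inter> sphere 0 1|circle. f z) + (LINT z:(UNIV - A) \<inter> sphere 0 1|circle. f z)"
        by (rule set_integral_Un) (use A in \<open>auto intro!: int sets\<close>)
      finally show ?case using full compl by simp
    next
      case (union A)
      then have A: "A i \<in> sets borel" for i by (auto simp: borel_eq_closed)
      have "(LINT z:(\<Union>i. A i \<inter> sphere 0 1)|circle. f z) = (\<Sum>i. LINT z:A i \<inter> sphere 0 1|circle. f z)"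
      proof (rule lebesgue_integral_countable_add)
        show "(A i \<inter> sphere 0 1) \<inter> (A j \<inter> sphere 0 1) = {}" if "i \<noteq> j" for i j
          using union(1) that by (auto simp: disjoint_family_on_def)
        show "set_integrable circle (\<Union>i. A i \<inter> sphere 0 1) f"
          by (intro int sets.countable_UN) (use A sets in auto)
      qed (use A sets in auto)
      moreover have "(\<Union>i. A i \<inter> sphere 0 1) = (\<Union>i. A i) \<inter> sphere 0 1"
        by blast
      ultimately show ?case using union(3) by simp
    qed
  qed
  fix A assume "A \<in> sets circle"
  then obtain B where "B \<in> sets borel" "A = B \<inter> sphere 0 1"
    by (auto simp: sets_circle sets_restrict_space)
  with zero show "(LINT z:A|circle. f z) = 0" by simp
qed

section \<open>Completeness and power series in the Hardy space\<close>

definition power_partial_sum :: "(nat \<Rightarrow> complex) \<Rightarrow> nat \<Rightarrow> complex \<Rightarrow> complex" where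
  "power_partial_sum c N z = (\<Sum>n<N. c n * z ^ n)"

lemma L2_power_partial_sum: "power_partial_sum c N \<in> L2"
  unfolding power_partial_sum_def[abs_def] by (rule L2_power_sum)

lemma mean_square_power_partial_sum_diff:
  assumes "M \<le> N"
  shows "mean_square (\<lambda>z. power_partial_sum c N z - power_partial_sum c M z) =
           (\<Sum>n\<in>{M..<N}. (norm (c n))\<^sup>2)"
proof -
  have "power_partial_sum c N z - power_partial_sum c M z = (\<Sum>n\<in>{M..<N}. c n * z ^ n)" for z
    using sum_diff_nat_ivl[of 0 M N "\<lambda>n. c n * z ^ n"] assms
    by (simp add: power_partial_sum_def atLeast0LessThan)
  then show ?thesis by (simp add: mean_square_power_sum)
qed

text \<open>
  The partial sums of a power series with square-summable coefficients are Cauchy in \<open>L\<^sup>1\<close>, so a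
  subsequence converges almost everywhere. The pointwise limit is the required function, because
  Fatou's lemma along that subsequence bounds its distance to the \<open>N\<close>-th partial sum by the
  tail of the series from \<open>N\<close> on.
\<close>

theorem riesz_fischer:
  fixes c :: "nat \<Rightarrow> complex"
  assumes c: "summable (\<lambda>n. (norm (c n))\<^sup>2)"
  shows "\<exists>g\<in>L2. (\<lambda>N. mean_square (\<lambda>z. g z - power_partial_sum c N z)) \<longlonglongrightarrow> 0"
proof -
  let ?S = "power_partial_sum c"
  define a where "a n = (norm (c n))\<^sup>2" for n
  have a: "summable a" "\<And>n. a n \<ge> 0" using c by (simp_all add: a_def[abs_def])
  have SL2: "?S N \<in> L2" for N by (rule L2_power_partial_sum)
  have Sm[measurable]: "?S N \<in> borel_measurable circle" for N by (rule L2_measurable[OF SL2])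
  have cauchy: "\<exists>N. \<forall>i\<ge>N. \<forall>j\<ge>N. (\<integral>z. norm (?S i z - ?S j z) \<partial>circle) < e" if "e > 0" for e
  proof -
    have "e\<^sup>2 > 0" using that by simp
    then obtain N where N: "\<And>m n. m \<ge> N \<Longrightarrow> norm (sum a {m..<n}) < e\<^sup>2"
      using a(1)[unfolded summable_Cauchy] by blast
    have less: "(\<integral>z. norm (?S i z - ?S j z) \<partial>circle) < e" if "j \<ge> N" "j \<le> i" for i j
    proof -
      have "(\<integral>z. norm (?S i z - ?S j z) \<partial>circle) \<le> sqrt (mean_square (\<lambda>z. ?S i z - ?S j z))"
        by (intro integral_norm_le_mean_square L2_diff SL2)
      also have "\<dots> = sqrt (sum a {j..<i})"
        using that by (simp add: mean_square_power_partial_sum_diff a_def)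
      also have "\<dots> < sqrt (e\<^sup>2)"
        using N[OF that(1), of i] by (intro real_sqrt_less_mono) simp
      finally show ?thesis using \<open>e > 0\<close> by simp
    qed
    have "(\<integral>z. norm (?S i z - ?S j z) \<partial>circle) < e" if "i \<ge> N" "j \<ge> N" for i j
      using less[of j i] less[of i j] that by (cases "j \<le> i") (auto simp: norm_minus_commute)
    then show ?thesis by blast
  qed
  have Sint: "integrable circle (?S N)" for N
    using integrable_mult_L2[OF SL2[of N], of "\<lambda>_. 1"] by (simp add: L2_def)
  obtain r where r: "strict_mono r" "AE z in circle. Cauchy (\<lambda>k. ?S (r k) z)"
    using cauchy_L1_AE_cauchy_subseq[OF Sint cauchy] by blast
  define g where "g z = lim (\<lambda>k. ?S (r k) z)" for z
  have gm[measurable]: "g \<in> borel_measurable circle"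
    unfolding g_def[abs_def] by (rule borel_measurable_lim_metric) (rule Sm)
  have conv: "AE z in circle. (\<lambda>k. ?S (r k) z) \<longlonglongrightarrow> g z"
    using r(2) by eventually_elim (simp add: g_def Cauchy_convergent_iff convergent_LIMSEQ_iff)
  \<comment> \<open>The tail of the series, to which Fatou's lemma compares the squared distance to the \<open>N\<close>-th sum.\<close>
  define T where "T N = suminf a - sum a {..<N}" for N
  have T: "T N \<ge> 0" for N
    using sum_le_suminf[OF a(1), of "{..<N}"] a(2) by (simp add: T_def)
  have bound: "(\<integral>\<^sup>+z. ennreal ((norm (g z - ?S N z))\<^sup>2) \<partial>circle) \<le> ennreal (T N)" for N
  proof -
    have "(\<integral>\<^sup>+z. ennreal ((norm (g z - ?S N z))\<^sup>2) \<partial>circle) =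
        (\<integral>\<^sup>+z. liminf (\<lambda>k. ennreal ((norm (?S (r k) z - ?S N z))\<^sup>2)) \<partial>circle)"
    proof (rule nn_integral_cong_AE, use conv in eventually_elim)
      fix z assume "(\<lambda>k. ?S (r k) z) \<longlonglongrightarrow> g z"
      then have "(\<lambda>k. ennreal ((norm (?S (r k) z - ?S N z))\<^sup>2)) \<longlonglongrightarrow> ennreal ((norm (g z - ?S N z))\<^sup>2)"
        by (intro tendsto_ennrealI tendsto_intros)
      then show "ennreal ((norm (g z - ?S N z))\<^sup>2) = liminf (\<lambda>k. ennreal ((norm (?S (r k) z - ?S N z))\<^sup>2))"
        by (intro lim_imp_Liminf[symmetric]) auto
    qed
    also have "\<dots> \<le> liminf (\<lambda>k. \<integral>\<^sup>+z. ennreal ((norm (?S (r k) z - ?S N z))\<^sup>2) \<partial>circle)"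
      by (rule nn_integral_liminf) measurable
    also have "\<dots> \<le> limsup (\<lambda>k. \<integral>\<^sup>+z. ennreal ((norm (?S (r k) z - ?S N z))\<^sup>2) \<partial>circle)"
      by (rule Liminf_le_Limsup) simp
    also have "\<dots> \<le> ennreal (T N)"
    proof (rule Limsup_bounded)
      show "\<forall>\<^sub>F k in sequentially. (\<integral>\<^sup>+z. ennreal ((norm (?S (r k) z - ?S N z))\<^sup>2) \<partial>circle) \<le> ennreal (T N)"
        using eventually_ge_at_top[of N]
      proof eventually_elim
        case (elim k)
        then have N: "N \<le> r k" using seq_suble[OF r(1), of k] by linarith
        have "sum a {N..<r k} = sum a {..<r k} - sum a {..<N}"
          using sum_diff_nat_ivl[of 0 N "r k" a] N by (simp add: atLeast0LessThan)
        also have "\<dots> \<le> T N"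
          using sum_le_suminf[OF a(1), of "{..<r k}"] a(2) by (simp add: T_def)
        finally show ?case
          using N by (subst nn_integral_norm_square[OF L2_diff[OF SL2 SL2]])
            (simp add: mean_square_power_partial_sum_diff a_def ennreal_leI)
      qed
    qed
    finally show ?thesis .
  qed
  have D: "(\<lambda>z. g z - ?S N z) \<in> L2" for N
  proof -
    have "integrable circle (\<lambda>z. (norm (g z - ?S N z))\<^sup>2)"
    proof (rule integrableI_bounded)
      show "(\<integral>\<^sup>+z. ennreal (norm ((norm (g z - ?S N z))\<^sup>2)) \<partial>circle) < \<infinity>"
        using bound[of N] by (simp add: le_less_trans)
    qed measurable
    then show ?thesis by (simp add: L2_def)
  qed
  have "g \<in> L2"
    using L2_add[OF D[of 0] SL2[of 0]] by simp
  moreover have "(\<lambda>N. mean_square (\<lambda>z. g z - ?S N z)) \<longlonglongrightarrow> 0"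
  proof (rule tendsto_sandwich[where f="\<lambda>_. 0" and h=T])
    have "(\<lambda>N. suminf a - sum a {..<N}) \<longlonglongrightarrow> suminf a - suminf a"
      by (intro tendsto_diff tendsto_const summable_LIMSEQ a)
    then show "T \<longlonglongrightarrow> 0" by (simp add: T_def[abs_def])
    have "mean_square (\<lambda>z. g z - ?S N z) \<le> T N" for N
      using bound[of N] T[of N] by (simp add: nn_integral_norm_square[OF D] ennreal_le_iff)
    then show "\<forall>\<^sub>F N in sequentially. mean_square (\<lambda>z. g z - ?S N z) \<le> T N" by simp
  qed (auto simp: mean_square_nonneg)
  ultimately show ?thesis by blast
qed

lemma L2_inner_tendsto:
  assumes "\<And>N. S N \<in> L2" "g \<in> L2" "h \<in> L2"
    and lim: "(\<lambda>N. mean_square (\<lambda>z. g z - S N z)) \<longlonglongrightarrow> 0"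
  shows "(\<lambda>N. L2_inner (S N) h) \<longlonglongrightarrow> L2_inner g h"
proof -
  have "(\<lambda>N. sqrt (mean_square (\<lambda>z. g z - S N z) * mean_square h)) \<longlonglongrightarrow> sqrt (0 * mean_square h)"
    by (intro tendsto_intros lim)
  then have lim': "(\<lambda>N. sqrt (mean_square (\<lambda>z. g z - S N z) * mean_square h)) \<longlonglongrightarrow> 0"
    by simp
  have "norm (L2_inner g h - L2_inner (S N) h) \<le> sqrt (mean_square (\<lambda>z. g z - S N z) * mean_square h)" for N
    using norm_L2_inner_le[OF L2_diff[OF assms(2) assms(1)] assms(3), of N]
    by (simp add: L2_inner_diff_left assms)
  then have "(\<lambda>N. L2_inner g h - L2_inner (S N) h) \<longlonglongrightarrow> 0"
    by (intro Lim_null_comparison[OF _ lim']) auto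
  then show ?thesis
    using tendsto_diff[OF tendsto_const[of "L2_inner g h"], of "\<lambda>N. L2_inner g h - L2_inner (S N) h" 0]
    by simp
qed

lemma fourier_coeff_power_partial_sum:
  "fourier_coeff (power_partial_sum c N) k = (if 0 \<le> k \<and> k < int N then c (nat k) else 0)"
proof -
  have "fourier_coeff (power_partial_sum c N) k = (\<Sum>n<N. c n * fourier_coeff (\<lambda>z. z powi (int n)) k)"
    unfolding power_partial_sum_def[abs_def] fourier_coeff_def
    by (subst L2_inner_sum_left) (auto simp: L2_cmult L2_power L2_powi L2_inner_cmult_left)
  also have "\<dots> = (\<Sum>n<N. if n = nat k \<and> 0 \<le> k then c n else 0)"
    by (rule sum.cong) (auto simp: fourier_coeff_powi simp del: power_int_of_nat)
  also have "\<dots> = (if 0 \<le> k \<and> k < int N then c (nat k) else 0)"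
    by (cases "0 \<le> k") (auto simp: nat_less_iff)
  finally show ?thesis .
qed

lemma fourier_uniqueness_L2:
  assumes f: "f \<in> L2" and "\<And>n. fourier_coeff f n = 0"
  shows "AE z in circle. f z = 0"
proof (rule fourier_uniqueness)
  show "integrable circle f"
    using integrable_mult_L2[OF f, of "\<lambda>_. 1"] by (simp add: L2_def)
  show "(\<integral>z. f z * z powi n \<partial>circle) = 0" for n
  proof -
    have "(\<integral>z. f z * z powi n \<partial>circle) = fourier_coeff f (- n)"
      unfolding fourier_coeff_def L2_inner_def
      by (rule Bochner_Integration.integral_cong)
         (auto simp: space_circle cnj_powi_circle simp del: complex_cnj_power_int)
    then show ?thesis using assms by simp
  qed
qed

text \<open>
  The sum of the nonnegative part of the Fourier series; it will turn out to be the projection of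
  \<open>f\<close> onto \<open>H\<^sup>2\<close>.
\<close>

lemma fourier_series_nonneg_part:
  assumes f: "f \<in> L2"
  defines "S \<equiv> power_partial_sum (\<lambda>n. fourier_coeff f (int n))"
  obtains g where "g \<in> H2" "\<And>n. n \<ge> 0 \<Longrightarrow> fourier_coeff g n = fourier_coeff f n"
    "(\<lambda>N. mean_square (\<lambda>z. g z - S N z)) \<longlonglongrightarrow> 0"
proof -
  have "summable (\<lambda>n. (norm (fourier_coeff f (int n)))\<^sup>2)"
    by (rule summableI_nonneg_bounded[where x="mean_square f"]) (auto intro: bessel f)
  from riesz_fischer[OF this]
  obtain g where g: "g \<in> L2" "(\<lambda>N. mean_square (\<lambda>z. g z - S N z)) \<longlonglongrightarrow> 0"
    unfolding S_def by blast
  have lim: "(\<lambda>N. fourier_coeff (S N) k) \<longlonglongrightarrow> fourier_coeff g k" for k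
    unfolding fourier_coeff_def
    by (rule L2_inner_tendsto[OF _ g(1) L2_powi g(2)]) (simp add: S_def L2_power_partial_sum)
  have coeff: "fourier_coeff g k = (if 0 \<le> k then fourier_coeff f k else 0)" for k
  proof -
    have "eventually (\<lambda>N. fourier_coeff (S N) k = (if 0 \<le> k then fourier_coeff f k else 0)) sequentially"
      using eventually_gt_at_top[of "nat k"]
      by eventually_elim (auto simp: S_def fourier_coeff_power_partial_sum)
    then have "(\<lambda>N. fourier_coeff (S N) k) \<longlonglongrightarrow> (if 0 \<le> k then fourier_coeff f k else 0)"
      by (rule tendsto_eventually)
    then show ?thesis using lim LIMSEQ_unique by blast
  qed
  show ?thesis
    by (rule that[of g]) (use g coeff in \<open>auto simp: H2_def\<close>)
qed

text \<open>
  The partial sums converge to some function with the same coefficients as \<open>s\<close>, and by uniqueness of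
  Fourier coefficients that function is \<open>s\<close>.
\<close>

lemma H2_fourier_series:
  assumes s: "s \<in> H2"
  shows "(\<lambda>N. mean_square (\<lambda>z. s z - power_partial_sum (\<lambda>n. fourier_coeff s (int n)) N z)) \<longlonglongrightarrow> 0"
proof -
  let ?S = "power_partial_sum (\<lambda>n. fourier_coeff s (int n))"
  have sL2: "s \<in> L2" using s by (simp add: H2_def)
  obtain g where g: "g \<in> H2" "\<And>n. n \<ge> 0 \<Longrightarrow> fourier_coeff g n = fourier_coeff s n"
    "(\<lambda>N. mean_square (\<lambda>z. g z - ?S N z)) \<longlonglongrightarrow> 0"
    using fourier_series_nonneg_part[OF sL2] by blast
  have gL2: "g \<in> L2" using g by (simp add: H2_def)
  have "AE z in circle. s z - g z = 0"
  proof (rule fourier_uniqueness_L2[OF L2_diff[OF sL2 gL2]])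
    fix n show "fourier_coeff (\<lambda>z. s z - g z) n = 0"
      using g s by (cases "n \<ge> 0") (auto simp: fourier_coeff_diff sL2 gL2 H2_def)
  qed
  then have "mean_square (\<lambda>z. s z - ?S N z) = mean_square (\<lambda>z. g z - ?S N z)" for N
    unfolding mean_square_def
    using L2_measurable[OF sL2] L2_measurable[OF gL2] L2_measurable[OF L2_power_partial_sum]
    by (intro integral_cong_AE) auto
  then show ?thesis using g(3) by simp
qed

text \<open>
  By continuity of the inner product it suffices to test against the monomials \<open>z ^ n\<close>, since these
  span a dense subspace of \<open>H\<^sup>2\<close>. This turns conditions on Fourier coefficients into orthogonality
  to all of \<open>H\<^sup>2\<close>.
\<close>

lemma L2_inner_H2_eq_0:
  assumes f: "f \<in> L2" "\<And>n. n \<ge> 0 \<Longrightarrow> fourier_coeff f n = 0" and s: "s \<in> H2"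
  shows "L2_inner f s = 0"
proof -
  let ?S = "power_partial_sum (\<lambda>n. fourier_coeff s (int n))"
  have sL2: "s \<in> L2" using s by (simp add: H2_def)
  have "L2_inner (?S N) f = 0" for N
  proof -
    have "L2_inner (\<lambda>z. z ^ n) f = 0" for n
      using arg_cong[OF f(2)[of "int n"], of cnj] by (simp add: fourier_coeff_nat L2_inner_cnj)
    then show ?thesis
      unfolding power_partial_sum_def[abs_def]
      by (subst L2_inner_sum_left) (auto simp: L2_cmult L2_power L2_inner_cmult_left f)
  qed
  then have "L2_inner s f = 0"
    using L2_inner_tendsto[OF L2_power_partial_sum sL2 f(1) H2_fourier_series[OF s]]
    by (simp add: LIMSEQ_const_iff)
  then show ?thesis using L2_inner_cnj[of s f] by simp
qed

section \<open>The projection onto the Hardy space\<close>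

lemma H2_L2: "f \<in> H2 \<Longrightarrow> f \<in> L2"
  by (simp add: H2_def)

lemma H2_cmult: "f \<in> H2 \<Longrightarrow> (\<lambda>z. c * f z) \<in> H2"
  by (simp add: H2_def L2_cmult fourier_coeff_cmult)

lemma H2_diff: "f \<in> H2 \<Longrightarrow> g \<in> H2 \<Longrightarrow> (\<lambda>z. f z - g z) \<in> H2"
  by (simp add: H2_def L2_diff fourier_coeff_diff)

lemma H2_const: "(\<lambda>z. c) \<in> H2"
  using fourier_coeff_powi[of 0] L2_powi[of 0] H2_cmult[of "\<lambda>_. 1" c]
  by (simp add: H2_def)

lemma H2_powi: "n \<ge> 0 \<Longrightarrow> (\<lambda>z. z powi n) \<in> H2"
  by (simp add: H2_def L2_powi fourier_coeff_powi)

lemma L2_powi_mult: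
  assumes "f \<in> L2"
  shows "(\<lambda>z. z powi n * f z) \<in> L2"
proof (rule L2_bounded_mult[OF L2_measurable[OF L2_powi] _ assms])
  show "AE z in circle. norm (z powi n) \<le> 1"
    by (rule AE_I2) (simp add: space_circle norm_power_int)
qed

lemma H2_powi_mult: "f \<in> H2 \<Longrightarrow> n \<ge> 0 \<Longrightarrow> (\<lambda>z. z powi n * f z) \<in> H2"
  by (simp add: H2_def L2_powi_mult fourier_coeff_powi_mult)

lemma L2_Linf_mult: "\<phi> \<in> Linf \<Longrightarrow> f \<in> L2 \<Longrightarrow> (\<lambda>z. \<phi> z * f z) \<in> L2"
  using L2_bounded_mult unfolding Linf_def by blast

lemma Linf_L2: "\<phi> \<in> Linf \<Longrightarrow> \<phi> \<in> L2"
  using L2_Linf_mult[of \<phi> "\<lambda>_. 1"] H2_L2[OF H2_const[of 1]] by simp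

text \<open>
  The projection is introduced by a choice operator, so its defining property needs a witness: the
  nonnegative part of the Fourier series of \<open>f\<close>.
\<close>

lemma P_proj_spec:
  assumes f: "f \<in> L2"
  shows "P_proj f \<in> H2" "s \<in> H2 \<Longrightarrow> L2_inner (\<lambda>z. f z - P_proj f z) s = 0"
proof -
  obtain g where g: "g \<in> H2" "\<And>n. n \<ge> 0 \<Longrightarrow> fourier_coeff g n = fourier_coeff f n"
    using fourier_series_nonneg_part[OF f] by blast
  have "L2_inner (\<lambda>z. f z - g z) s = 0" if "s \<in> H2" for s
    by (rule L2_inner_H2_eq_0[OF _ _ that]) (auto simp: L2_diff fourier_coeff_diff f H2_L2 g)
  then have "\<exists>g. g \<in> H2 \<and> (\<forall>s\<in>H2. L2_inner (\<lambda>z. f z - g z) s = 0)"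
    using g(1) by blast
  from someI_ex[OF this]
  show "P_proj f \<in> H2" "s \<in> H2 \<Longrightarrow> L2_inner (\<lambda>z. f z - P_proj f z) s = 0"
    unfolding P_proj_def ortho_proj_def by blast+
qed

lemma P_proj_L2: "f \<in> L2 \<Longrightarrow> P_proj f \<in> L2"
  by (rule H2_L2[OF P_proj_spec(1)])

lemma P_proj_unique:
  assumes f: "f \<in> L2" and g: "g \<in> H2" and orth: "\<And>s. s \<in> H2 \<Longrightarrow> L2_inner (\<lambda>z. f z - g z) s = 0"
  shows "AE z in circle. P_proj f z = g z"
proof -
  let ?d = "\<lambda>z. P_proj f z - g z"
  have d: "?d \<in> H2" by (intro H2_diff P_proj_spec f g)
  have "L2_inner ?d ?d = L2_inner (\<lambda>z. (f z - g z) - (f z - P_proj f z)) ?d"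
    by simp
  also have "\<dots> = L2_inner (\<lambda>z. f z - g z) ?d - L2_inner (\<lambda>z. f z - P_proj f z) ?d"
    by (intro L2_inner_diff_left L2_diff f H2_L2 g d P_proj_spec)
  also have "\<dots> = 0"
    using orth[OF d] P_proj_spec(2)[OF f d] by simp
  finally have "mean_square ?d = 0" by (simp add: L2_inner_self)
  then show ?thesis
    using mean_square_eq_0_iff[OF H2_L2[OF d]] by simp
qed

text \<open>
  Homogeneity and compatibility with almost-everywhere equality, in one statement because both follow
  from uniqueness of the projection.
\<close>

lemma P_proj_cmult_cong_AE:
  assumes f: "f \<in> L2" "g \<in> L2" and eq: "AE z in circle. f z = c * g z"
  shows "AE z in circle. P_proj f z = c * P_proj g z"
proof (rule P_proj_unique[OF f(1)])
  show "(\<lambda>z. c * P_proj g z) \<in> H2" by (intro H2_cmult P_proj_spec f)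
  fix s assume s: "s \<in> H2"
  have "L2_inner (\<lambda>z. f z - c * P_proj g z) s = L2_inner (\<lambda>z. c * (g z - P_proj g z)) s"
  proof (rule L2_inner_cong_AE)
    show "AE z in circle. f z - c * P_proj g z = c * (g z - P_proj g z)"
      using eq by eventually_elim (simp add: algebra_simps)
  qed (auto intro!: L2_measurable L2_diff L2_cmult P_proj_L2 f H2_L2[OF s])
  also have "\<dots> = 0"
    by (simp add: L2_inner_cmult_left P_proj_spec(2) f s)
  finally show "L2_inner (\<lambda>z. f z - c * P_proj g z) s = 0" .
qed

lemma P_proj_eq_constant:
  assumes f: "f \<in> L2" "\<And>n. n > 0 \<Longrightarrow> fourier_coeff f n = 0"
  shows "AE z in circle. P_proj f z = fourier_coeff f 0"
proof (rule P_proj_unique[OF f(1) H2_const])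
  fix s assume s: "s \<in> H2"
  have cL2: "(\<lambda>z. fourier_coeff f 0) \<in> L2" by (rule H2_L2[OF H2_const])
  have cc: "fourier_coeff (\<lambda>z. fourier_coeff f 0) n = fourier_coeff f 0 * of_bool (n = 0)" for n
    using fourier_coeff_cmult[of "fourier_coeff f 0" "\<lambda>z. z powi 0" n] fourier_coeff_powi[of 0 n]
    by auto
  show "L2_inner (\<lambda>z. f z - fourier_coeff f 0) s = 0"
  proof (rule L2_inner_H2_eq_0[OF L2_diff[OF f(1) cL2] _ s])
    fix n :: int assume "n \<ge> 0"
    then show "fourier_coeff (\<lambda>z. f z - fourier_coeff f 0) n = 0"
      using f(2)[of n] by (cases "n = 0") (auto simp: fourier_coeff_diff[OF f(1) cL2] cc)
  qed
qed

lemma P_proj_H2: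
  assumes "f \<in> H2"
  shows "AE z in circle. P_proj f z = f z"
  by (rule P_proj_unique) (use assms in \<open>auto simp: H2_L2 L2_inner_def\<close>)

section \<open>The operators for an inner function\<close>

locale inner_fun =
  fixes \<theta> :: "complex \<Rightarrow> complex"
  assumes inner: "inner_function \<theta>"
begin

lemma theta_measurable: "\<theta> \<in> borel_measurable circle"
  using inner by (simp add: inner_function_def)

lemma theta_norm: "AE z in circle. norm (\<theta> z) = 1"
  using inner by (simp add: inner_function_def)

lemma theta_L2: "\<theta> \<in> L2"
proof -
  have "AE z in circle. norm (\<theta> z) \<le> 1"
    using theta_norm by eventually_elim simp
  from L2_bounded_mult[OF theta_measurable this H2_L2[OF H2_const[of 1]]] show ?thesis by simp
qed

lemma theta_mult_L2: "f \<in> L2 \<Longrightarrow> (\<lambda>z. \<theta> z * f z) \<in> L2"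
  by (rule L2_bounded_mult[OF theta_measurable, of 1]) (use theta_norm in auto)

lemma cnj_theta_mult_L2: "f \<in> L2 \<Longrightarrow> (\<lambda>z. cnj (\<theta> z) * f z) \<in> L2"
  by (rule L2_bounded_mult[OF L2_measurable[OF L2_cnj[OF theta_L2]], of 1]) (use theta_norm in auto)

text \<open>
  On the circles of radius \<open>r < 1\<close> the integrals that give the negative coefficients vanish by Cauchy's
  theorem. As \<open>\<theta>\<close> is bounded on the disk and has radial limits almost everywhere, dominated
  convergence carries this to the boundary.
\<close>

lemma theta_H2: "\<theta> \<in> H2"
proof -
  have hol: "\<theta> holomorphic_on ball 0 1" using inner by (simp add: inner_function_def)
  obtain B where "\<forall>z\<in>ball 0 1. norm (\<theta> z) \<le> B"
    using inner unfolding inner_function_def bounded_iff by blast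
  then have B: "norm (\<theta> z) \<le> B" if "norm z < 1" for z
    using that by simp
  have "fourier_coeff \<theta> n = 0" if "n < 0" for n
  proof -
    define m where "m = nat (- n)"
    have m: "m \<ge> 1" "n = - int m" using that by (auto simp: m_def)
    \<comment> \<open>Dominated convergence needs a sequence of radii; this one stays strictly between \<open>0\<close> and \<open>1\<close>.\<close>
    define r where "r k = 1 - 1 / (real k + 2)" for k :: nat
    have r: "0 < r k" "r k < 1" for k by (auto simp: r_def field_simps)
    have "r \<longlonglongrightarrow> 1" unfolding r_def by real_asymp
    then have r_lim: "filterlim r (at_left 1) sequentially"
      using r by (auto simp: filterlim_at intro!: always_eventually less_imp_neq)
    have small: "norm (of_real (r k) * z) < 1" if "norm z \<le> 1" for k and z :: complex
    proof -
      have "norm (of_real (r k) * z) = r k * norm z" using r[of k] by (simp add: norm_mult)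
      also have "\<dots> \<le> r k" using that r[of k] by (intro mult_left_le) auto
      finally show ?thesis using r[of k] by simp
    qed
    have int0: "(\<integral>z. \<theta> (of_real (r k) * z) * z ^ m \<partial>circle) = 0" for k
    proof (rule integral_circle_holomorphic[of _ "1 / r k"])
      have "((\<theta> \<circ> (\<lambda>z. of_real (r k) * z)) holomorphic_on ball 0 (1 / r k))"
      proof (rule holomorphic_on_compose_gen[OF _ hol])
        show "(\<lambda>z. complex_of_real (r k) * z) ` ball 0 (1 / r k) \<subseteq> ball 0 1"
          using r[of k] by (auto simp: norm_mult field_simps)
      qed (intro holomorphic_intros)
      then show "(\<lambda>z. \<theta> (of_real (r k) * z)) holomorphic_on ball 0 (1 / r k)"
        by (simp add: o_def)
      show "1 < 1 / r k" using r[of k] by simp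
    qed (use m in auto)
    have "(\<lambda>k. \<integral>z. \<theta> (of_real (r k) * z) * z ^ m \<partial>circle) \<longlonglongrightarrow> (\<integral>z. \<theta> z * z ^ m \<partial>circle)"
    proof (rule integral_dominated_convergence[where w="\<lambda>_. B"])
      show "(\<lambda>z. \<theta> z * z ^ m) \<in> borel_measurable circle"
        using theta_measurable L2_measurable[OF L2_power] by measurable
      show "(\<lambda>z. \<theta> (of_real (r k) * z) * z ^ m) \<in> borel_measurable circle" for k
        by (intro borel_measurable_circle_continuous continuous_intros
            continuous_on_compose2[OF holomorphic_on_imp_continuous_on[OF hol]])
           (use small in auto)
      show "AE z in circle. (\<lambda>k. \<theta> (of_real (r k) * z) * z ^ m) \<longlonglongrightarrow> \<theta> z * z ^ m"
      proof -
        have "AE z in circle. ((\<lambda>r. \<theta> (of_real r * z)) \<longlongrightarrow> \<theta> z) (at_left 1)"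
          using inner by (simp add: inner_function_def)
        then show ?thesis
          by eventually_elim (intro tendsto_intros filterlim_compose[OF _ r_lim])
      qed
      show "AE z in circle. norm (\<theta> (of_real (r k) * z) * z ^ m) \<le> B" for k
      proof (rule AE_I2)
        fix z assume "z \<in> space circle"
        then have "norm z = 1" by (simp add: space_circle)
        then show "norm (\<theta> (of_real (r k) * z) * z ^ m) \<le> B"
          using B[OF small[of z k]] by (simp add: norm_mult norm_power)
      qed
    qed simp
    then have "(\<integral>z. \<theta> z * z ^ m \<partial>circle) = 0"
      using int0 by (simp add: LIMSEQ_const_iff)
    moreover have "fourier_coeff \<theta> n = (\<integral>z. \<theta> z * z ^ m \<partial>circle)"
      unfolding fourier_coeff_def L2_inner_def
      by (rule Bochner_Integration.integral_cong)
         (auto simp: space_circle cnj_powi_circle m simp del: complex_cnj_power_int)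
    ultimately show ?thesis by simp
  qed
  then show ?thesis by (simp add: H2_def theta_L2)
qed

lemma L2_inner_cnj_theta: "L2_inner (\<lambda>z. cnj (\<theta> z) * f z) g = L2_inner f (\<lambda>z. \<theta> z * g z)"
  by (simp add: L2_inner_def mult_ac)

lemma theta_powi_H2: "n \<ge> 0 \<Longrightarrow> (\<lambda>z. \<theta> z * z powi n) \<in> H2"
  using H2_powi_mult[OF theta_H2] by (simp add: mult.commute)

lemma K_space_L2: "u \<in> K_space \<theta> \<Longrightarrow> u \<in> L2"
  by (simp add: K_space_def ortho_minus_def H2_L2)

lemma Q_theta_cmult_cong_AE:
  assumes f: "f \<in> L2" "g \<in> L2" and eq: "AE z in circle. f z = c * g z"
  shows "AE z in circle. Q_theta \<theta> f z = c * Q_theta \<theta> g z"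
proof -
  have "AE z in circle. cnj (\<theta> z) * f z = c * (cnj (\<theta> z) * g z)"
    using eq by eventually_elim simp
  from P_proj_cmult_cong_AE[OF cnj_theta_mult_L2[OF f(1)] cnj_theta_mult_L2[OF f(2)] this]
    P_proj_cmult_cong_AE[OF f eq] eq
  show ?thesis
    by eventually_elim (simp add: Q_theta_def Q_proj_def algebra_simps)
qed

text \<open>
  The two summands of \<open>Q_theta \<theta> f\<close> are orthogonal to \<open>H\<^sup>2\<close> and contained in \<open>\<theta> H\<^sup>2\<close>, respectively.
\<close>

lemma Q_theta_K_perp:
  assumes f: "f \<in> L2"
  shows "Q_theta \<theta> f \<in> K_perp \<theta>"
proof -
  let ?p = "P_proj (\<lambda>w. cnj (\<theta> w) * f w)"
  have p: "?p \<in> H2" by (intro P_proj_spec cnj_theta_mult_L2 f)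
  have L2: "(\<lambda>z. f z - P_proj f z) \<in> L2" "(\<lambda>z. \<theta> z * ?p z) \<in> L2"
    by (intro L2_diff f P_proj_L2 theta_mult_L2 H2_L2 p)+
  have "L2_inner (Q_theta \<theta> f) u = 0" if u: "u \<in> K_space \<theta>" for u
  proof -
    have uH2: "u \<in> H2" and uo: "L2_inner u (\<lambda>z. \<theta> z * ?p z) = 0"
      using u p by (auto simp: K_space_def ortho_minus_def)
    have "L2_inner (Q_theta \<theta> f) u =
        L2_inner (\<lambda>z. f z - P_proj f z) u + L2_inner (\<lambda>z. \<theta> z * ?p z) u"
      unfolding Q_theta_def Q_proj_def by (intro L2_inner_add_left L2 H2_L2 uH2)
    also have "L2_inner (\<lambda>z. \<theta> z * ?p z) u = 0"
      using arg_cong[OF uo, of cnj] by (simp add: L2_inner_cnj)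
    finally show ?thesis using P_proj_spec(2)[OF f uH2] by simp
  qed
  moreover have "Q_theta \<theta> f \<in> L2"
    unfolding Q_theta_def Q_proj_def by (intro L2_add L2)
  ultimately show ?thesis by (simp add: K_perp_def ortho_minus_def)
qed

lemma dual_trunc_hankel_K_perp:
  "\<phi> \<in> Linf \<Longrightarrow> h \<in> L2 \<Longrightarrow> dual_trunc_hankel \<theta> \<phi> h \<in> K_perp \<theta>"
  unfolding dual_trunc_hankel_def by (intro Q_theta_K_perp L2_flip L2_Linf_mult)

lemma K_perp_L2: "h \<in> K_perp \<theta> \<Longrightarrow> h \<in> L2"
  by (simp add: K_perp_def ortho_minus_def)

lemma dual_trunc_hankel_cmult_cong_AE:
  assumes "\<phi> \<in> Linf" "\<psi> \<in> Linf" "h \<in> L2" "k \<in> L2"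
    and eq: "AE z in circle. \<phi> z * h z = c * (\<psi> z * k z)"
  shows "AE z in circle. dual_trunc_hankel \<theta> \<phi> h z = c * dual_trunc_hankel \<theta> \<psi> k z"
  unfolding dual_trunc_hankel_def
proof (rule Q_theta_cmult_cong_AE)
  show "AE z in circle. flip (\<lambda>z. \<phi> z * h z) z = c * flip (\<lambda>z. \<psi> z * k z) z"
    using AE_circle_cnj[OF eq] by (simp add: flip_def)
qed (intro L2_flip L2_Linf_mult assms)+

text \<open>
  If \<open>A = c B\<close>, then \<open>A B\<close> and \<open>B A\<close> both equal \<open>c B\<^sup>2\<close>. The first equality applies the hypothesis at
  \<open>B h\<close>, which needs \<open>B\<close> to map into \<open>K_perp \<theta>\<close>; the second needs \<open>B\<close> to be homogeneous and to respect
  almost-everywhere equality.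
\<close>

lemma dual_trunc_hankel_commute_if_scalar:
  assumes "\<phi> \<in> Linf" "\<psi> \<in> Linf"
    and eq: "op_eq_on (K_perp \<theta>) (dual_trunc_hankel \<theta> \<phi>) (op_scale c (dual_trunc_hankel \<theta> \<psi>))"
    and h: "h \<in> K_perp \<theta>"
  shows "AE z in circle. dual_trunc_hankel \<theta> \<phi> (dual_trunc_hankel \<theta> \<psi> h) z =
           dual_trunc_hankel \<theta> \<psi> (dual_trunc_hankel \<theta> \<phi> h) z"
proof -
  let ?A = "dual_trunc_hankel \<theta> \<phi>" and ?B = "dual_trunc_hankel \<theta> \<psi>"
  have K: "?A h \<in> K_perp \<theta>" "?B h \<in> K_perp \<theta>"
    by (intro dual_trunc_hankel_K_perp assms K_perp_L2[OF h])+
  have scal: "AE z in circle. ?A k z = c * ?B k z" if "k \<in> K_perp \<theta>" for k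
    using eq that by (simp add: op_eq_on_def circle_eq_def op_scale_def)
  have "AE z in circle. ?B (?A h) z = c * ?B (?B h) z"
  proof (rule dual_trunc_hankel_cmult_cong_AE)
    show "AE z in circle. \<psi> z * ?A h z = c * (\<psi> z * ?B h z)"
      using scal[OF h] by eventually_elim simp
  qed (use assms K K_perp_L2 in auto)
  with scal[OF K(2)] show ?thesis by eventually_elim simp
qed

lemma powi_K_perp:
  assumes "n > 0"
  shows "(\<lambda>z. z powi (- n)) \<in> K_perp \<theta>"
proof -
  have "L2_inner (\<lambda>z. z powi (- n)) u = 0" if "u \<in> K_space \<theta>" for u
  proof (rule L2_inner_H2_eq_0[OF L2_powi])
    show "fourier_coeff (\<lambda>z. z powi (- n)) k = 0" if "k \<ge> 0" for k
      using assms that unfolding fourier_coeff_powi by simp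
    show "u \<in> H2" using that by (simp add: K_space_def ortho_minus_def)
  qed
  then show ?thesis by (simp only: K_perp_def ortho_minus_def mem_Collect_eq L2_powi) blast
qed

lemma op_scale_if_symbol_scale:
  assumes "\<phi> \<in> Linf" "\<psi> \<in> Linf" "AE z in circle. \<phi> z = c * \<psi> z"
  shows "op_eq_on (K_perp \<theta>) (dual_trunc_hankel \<theta> \<phi>) (op_scale c (dual_trunc_hankel \<theta> \<psi>))"
  unfolding op_eq_on_def circle_eq_def op_scale_def
proof
  fix h assume h: "h \<in> K_perp \<theta>"
  have "AE z in circle. \<phi> z * h z = c * (\<psi> z * h z)"
    using assms(3) by eventually_elim simp
  then show "AE z in circle. dual_trunc_hankel \<theta> \<phi> h z = c * dual_trunc_hankel \<theta> \<psi> h z"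
    by (intro dual_trunc_hankel_cmult_cong_AE assms K_perp_L2[OF h])
qed

text \<open>
  After the flip, the operator multiplies by \<open>flip \<phi>\<close>. The factor \<open>cnj \<theta>\<close> is the one that the definition of
  \<open>Q_theta\<close> applies before projecting, and also the one that the flip of an element of \<open>\<theta> H\<^sup>2\<close> contributes
  when \<open>\<theta>\<close> is symmetric; so this product occurs in both steps of the composition.
\<close>

definition twisted_symbol :: "(complex \<Rightarrow> complex) \<Rightarrow> complex \<Rightarrow> complex" where
  "twisted_symbol \<phi> z = cnj (\<theta> z) * flip \<phi> z"

lemma twisted_symbol_L2: "\<phi> \<in> L2 \<Longrightarrow> twisted_symbol \<phi> \<in> L2"
  unfolding twisted_symbol_def[abs_def] by (intro cnj_theta_mult_L2 L2_flip)

end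

section \<open>Commuting operators\<close>

locale symmetric_inner_fun = inner_fun +
  assumes symmetric: "circle_eq (star \<theta>) \<theta>" and vanish: "fourier_coeff \<theta> 0 = 0"
begin

lemma flip_theta: "AE z in circle. \<theta> (cnj z) = cnj (\<theta> z)"
  using symmetric unfolding circle_eq_def star_def
  by eventually_elim (metis complex_cnj_cnj)

text \<open>
  Since \<open>\<theta>\<close> has mean zero, the denominator in the definition of \<open>Z_space \<theta>\<close> is \<open>1\<close>.
\<close>

lemma flip_Z_space:
  assumes "\<phi> \<in> Z_space \<theta>"
  obtains a u where "u \<in> K_space \<theta>" "AE z in circle. flip \<phi> z = a * z powi (- 1) + u z"
proof -
  obtain a u where u: "u \<in> K_space \<theta>" and "AE z in circle. \<phi> z = a * z + flip u z"
    using assms vanish unfolding Z_space_def circle_eq_def by auto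
  from AE_circle_cnj[OF this(2)] AE_circle_norm
  have "AE z in circle. flip \<phi> z = a * z powi (- 1) + u z"
  proof eventually_elim
    case (elim z)
    then show ?case
      using cnj_powi_circle[OF elim(2), of 1] by (simp add: flip_def)
  qed
  with u show ?thesis by (rule that)
qed

lemma fourier_coeff_flip_Z_space:
  assumes "\<phi> \<in> Z_space \<theta>" "\<phi> \<in> L2" "n < - 1"
  shows "fourier_coeff (flip \<phi>) n = 0"
proof -
  obtain a u where u: "u \<in> K_space \<theta>" "AE z in circle. flip \<phi> z = a * z powi (- 1) + u z"
    using flip_Z_space[OF assms(1)] by blast
  have uH2: "u \<in> H2" using u by (simp add: K_space_def ortho_minus_def)
  have L2: "(\<lambda>z. a * z powi (- 1)) \<in> L2" by (intro L2_cmult L2_powi)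
  have "fourier_coeff (flip \<phi>) n = fourier_coeff (\<lambda>z. a * z powi (- 1) + u z) n"
    by (intro fourier_coeff_cong_AE u L2_measurable L2_flip assms L2_add L2 H2_L2[OF uH2])
  also have "\<dots> = a * fourier_coeff (\<lambda>z. z powi (- 1)) n + fourier_coeff u n"
    by (simp only: fourier_coeff_add[OF L2 H2_L2[OF uH2]] fourier_coeff_cmult)
  also have "\<dots> = 0"
    using uH2 assms(3) unfolding fourier_coeff_powi by (simp add: H2_def)
  finally show ?thesis .
qed

text \<open>
  Write \<open>flip \<phi> z = a * z powi (- 1) + u z\<close> with \<open>u\<close> in \<open>K_space \<theta>\<close>. For \<open>n \<ge> 0\<close> the \<open>n\<close>-th coefficient is
  the inner product of this with \<open>\<theta> z * z powi n\<close>. The part from \<open>u\<close> vanishes because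
  \<open>K_space \<theta>\<close> is orthogonal to \<open>\<theta> H\<^sup>2\<close>, and the other one because \<open>\<theta> z * z powi n\<close> has no
  coefficient of index \<open>- 1\<close>.
\<close>

lemma fourier_coeff_twisted_symbol:
  assumes "\<phi> \<in> Z_space \<theta>" "\<phi> \<in> L2" "n \<ge> 0"
  shows "fourier_coeff (twisted_symbol \<phi>) n = 0"
proof -
  obtain a u where u: "u \<in> K_space \<theta>" "AE z in circle. flip \<phi> z = a * z powi (- 1) + u z"
    using flip_Z_space[OF assms(1)] by blast
  have uL2: "u \<in> L2" by (rule K_space_L2[OF u(1)])
  have aL2: "(\<lambda>z. a * z powi (- 1)) \<in> L2" by (intro L2_cmult L2_powi)
  have tL2: "(\<lambda>z. \<theta> z * z powi n) \<in> L2" by (intro theta_mult_L2 L2_powi)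
  have "fourier_coeff (twisted_symbol \<phi>) n = L2_inner (flip \<phi>) (\<lambda>z. \<theta> z * z powi n)"
    unfolding twisted_symbol_def[abs_def] fourier_coeff_def by (rule L2_inner_cnj_theta)
  also have "\<dots> = L2_inner (\<lambda>z. a * z powi (- 1) + u z) (\<lambda>z. \<theta> z * z powi n)"
    by (intro L2_inner_cong_AE u L2_measurable L2_flip assms L2_add aL2 uL2 tL2) auto
  also have "\<dots> = a * L2_inner (\<lambda>z. z powi (- 1)) (\<lambda>z. \<theta> z * z powi n)
      + L2_inner u (\<lambda>z. \<theta> z * z powi n)"
    by (simp only: L2_inner_add_left[OF aL2 uL2 tL2] L2_inner_cmult_left)
  also have "L2_inner u (\<lambda>z. \<theta> z * z powi n) = 0"
    using u(1) H2_powi[OF assms(3)] by (auto simp: K_space_def ortho_minus_def)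
  also have "L2_inner (\<lambda>z. z powi (- 1)) (\<lambda>z. \<theta> z * z powi n) =
      cnj (fourier_coeff (\<lambda>z. z powi n * \<theta> z) (- 1))"
    unfolding fourier_coeff_def L2_inner_cnj by (simp only: mult.commute)
  also have "fourier_coeff (\<lambda>z. z powi n * \<theta> z) (- 1) = 0"
    using theta_H2 assms(3) unfolding fourier_coeff_powi_mult by (simp add: H2_def)
  finally show ?thesis by simp
qed

text \<open>
  The flip turns \<open>\<phi> z * z powi (- n)\<close> into \<open>F z = z powi n * flip \<phi> z\<close>, which is analytic, so that only
  the part \<open>\<theta> P (cnj \<theta> F)\<close> of the projection survives. Here \<open>cnj \<theta> F\<close> is the twisted symbol shifted by
  \<open>n\<close>; under the hypothesis on its coefficients, the constant term is all that \<open>P\<close> leaves.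
\<close>

lemma dual_trunc_hankel_powi:
  assumes \<phi>: "\<phi> \<in> Linf" "\<phi> \<in> Z_space \<theta>" and n: "n > 0"
    and top: "\<And>k. k > - n \<Longrightarrow> fourier_coeff (twisted_symbol \<phi>) k = 0"
  shows "AE z in circle. dual_trunc_hankel \<theta> \<phi> (\<lambda>z. z powi (- n)) z =
           fourier_coeff (twisted_symbol \<phi>) (- n) * \<theta> z"
proof -
  define F where "F = flip (\<lambda>z. \<phi> z * z powi (- n))"
  have \<phi>L2: "\<phi> \<in> L2" by (rule Linf_L2[OF \<phi>(1)])
  have FL2: "F \<in> L2" unfolding F_def by (intro L2_flip L2_Linf_mult \<phi> L2_powi)
  have F: "AE z in circle. F z = z powi n * flip \<phi> z"
    using AE_circle_norm
  proof eventually_elim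
    case (elim z)
    have "cnj z powi (- n) = z powi n"
      using cnj_powi_circle[OF elim, of "- n"] by (simp only: complex_cnj_power_int minus_minus)
    then show ?case by (simp only: F_def flip_def mult.commute)
  qed
  have "fourier_coeff F k = 0" if "k < 0" for k
  proof -
    have "fourier_coeff F k = fourier_coeff (\<lambda>z. z powi n * flip \<phi> z) k"
      by (intro fourier_coeff_cong_AE F L2_measurable FL2 L2_powi_mult L2_flip \<phi>L2)
    also have "\<dots> = 0"
      unfolding fourier_coeff_powi_mult
      by (rule fourier_coeff_flip_Z_space) (use \<phi> \<phi>L2 n that in auto)
    finally show ?thesis .
  qed
  then have FH2: "F \<in> H2" using FL2 by (simp add: H2_def)
  let ?G = "\<lambda>z. cnj (\<theta> z) * F z"
  have GL2: "?G \<in> L2" by (rule cnj_theta_mult_L2[OF FL2])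
  have G: "fourier_coeff ?G k = fourier_coeff (twisted_symbol \<phi>) (k - n)" for k
  proof -
    have "fourier_coeff ?G k = fourier_coeff (\<lambda>z. z powi n * twisted_symbol \<phi> z) k"
    proof (rule fourier_coeff_cong_AE)
      show "AE z in circle. cnj (\<theta> z) * F z = z powi n * twisted_symbol \<phi> z"
        using F by eventually_elim (simp add: twisted_symbol_def)
    qed (intro L2_measurable GL2 L2_powi_mult twisted_symbol_L2 \<phi>L2)+
    then show ?thesis by (simp only: fourier_coeff_powi_mult)
  qed
  have "AE z in circle. P_proj ?G z = fourier_coeff ?G 0"
    by (rule P_proj_eq_constant[OF GL2]) (simp add: G top)
  with P_proj_H2[OF FH2] show ?thesis
    unfolding dual_trunc_hankel_def F_def[symmetric] Q_theta_def Q_proj_def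
    by eventually_elim (simp add: G)
qed

text \<open>
  By the symmetry of \<open>\<theta>\<close>, the flip of \<open>\<psi> * (c * \<theta>)\<close> is \<open>c\<close> times the twisted symbol of \<open>\<psi>\<close>. It is orthogonal
  to \<open>H\<^sup>2\<close>, and so is its product with \<open>cnj \<theta>\<close>, so the projection onto \<open>K_perp \<theta>\<close> does not change it.
\<close>

lemma dual_trunc_hankel_theta:
  assumes \<psi>: "\<psi> \<in> Linf" "\<psi> \<in> Z_space \<theta>" and h: "h \<in> L2" "AE z in circle. h z = c * \<theta> z"
  shows "AE z in circle. dual_trunc_hankel \<theta> \<psi> h z = c * twisted_symbol \<psi> z"
proof -
  define F where "F = flip (\<lambda>z. \<psi> z * h z)"
  have \<psi>L2: "\<psi> \<in> L2" by (rule Linf_L2[OF \<psi>(1)])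
  have FL2: "F \<in> L2" unfolding F_def by (intro L2_flip L2_Linf_mult \<psi> h)
  have F: "AE z in circle. F z = c * twisted_symbol \<psi> z"
    using AE_circle_cnj[OF h(2)] flip_theta
    by eventually_elim (simp add: F_def flip_def twisted_symbol_def)
  have F0: "fourier_coeff F k = 0" if "k \<ge> 0" for k
  proof -
    have "fourier_coeff F k = fourier_coeff (\<lambda>z. c * twisted_symbol \<psi> z) k"
      by (intro fourier_coeff_cong_AE F L2_measurable FL2 L2_cmult twisted_symbol_L2 \<psi>L2)
    then show ?thesis
      using fourier_coeff_twisted_symbol[OF \<psi>(2) \<psi>L2 that] by (simp add: fourier_coeff_cmult)
  qed
  have "AE z in circle. P_proj F z = fourier_coeff F 0"
    by (rule P_proj_eq_constant[OF FL2]) (simp add: F0)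
  moreover have G: "fourier_coeff (\<lambda>z. cnj (\<theta> z) * F z) k = 0" if "k \<ge> 0" for k
    unfolding fourier_coeff_def L2_inner_cnj_theta
    by (rule L2_inner_H2_eq_0[OF FL2 F0 theta_powi_H2[OF that]])
  then have "AE z in circle. P_proj (\<lambda>z. cnj (\<theta> z) * F z) z = fourier_coeff (\<lambda>z. cnj (\<theta> z) * F z) 0"
    by (intro P_proj_eq_constant cnj_theta_mult_L2 FL2) simp
  ultimately show ?thesis
    using F unfolding dual_trunc_hankel_def F_def[symmetric] Q_theta_def Q_proj_def
    by eventually_elim (simp add: F0 G)
qed

text \<open>
  If both symbols vanish there is nothing to prove. Otherwise let \<open>- n\<close> be the largest index at which one
  of the twisted symbols has a nonzero coefficient. Both
  operators map \<open>z powi (- n)\<close> to a multiple of \<open>\<theta>\<close>, and commutation at this one vector is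
  already a nontrivial linear relation between the two twisted symbols, hence between \<open>\<phi>\<close> and \<open>\<psi>\<close>.
\<close>

lemma symbols_dependent_if_commute:
  assumes \<phi>: "\<phi> \<in> Linf" "\<phi> \<in> Z_space \<theta>" and \<psi>: "\<psi> \<in> Linf" "\<psi> \<in> Z_space \<theta>"
    and comm: "op_eq_on (K_perp \<theta>)
           (dual_trunc_hankel \<theta> \<phi> \<circ> dual_trunc_hankel \<theta> \<psi>)
           (dual_trunc_hankel \<theta> \<psi> \<circ> dual_trunc_hankel \<theta> \<phi>)"
  shows "(\<exists>c. AE z in circle. \<phi> z = c * \<psi> z) \<or> (\<exists>c. AE z in circle. \<psi> z = c * \<phi> z)"
proof -
  define a where "a n = fourier_coeff (twisted_symbol \<phi>) (- int n)" for n
  define b where "b n = fourier_coeff (twisted_symbol \<psi>) (- int n)" for n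
  have \<phi>L2: "\<phi> \<in> L2" and \<psi>L2: "\<psi> \<in> L2" using \<phi> \<psi> Linf_L2 by auto
  show ?thesis
  proof (cases "\<exists>n. a n \<noteq> 0 \<or> b n \<noteq> 0")
    case False
    have "fourier_coeff (twisted_symbol \<phi>) k = 0" for k
    proof (cases "k \<ge> 0")
      case True
      then show ?thesis by (rule fourier_coeff_twisted_symbol[OF \<phi>(2) \<phi>L2])
    next
      case k: False
      then have "fourier_coeff (twisted_symbol \<phi>) k = a (nat (- k))" by (simp add: a_def)
      then show ?thesis using False by simp
    qed
    then have "AE z in circle. twisted_symbol \<phi> z = 0"
      by (rule fourier_uniqueness_L2[OF twisted_symbol_L2[OF \<phi>L2]])
    with theta_norm have "AE z in circle. flip \<phi> z = 0"
      by eventually_elim (auto simp: twisted_symbol_def)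
    from AE_circle_cnj[OF this] have "AE z in circle. \<phi> z = 0 * \<psi> z"
      by (simp add: flip_def)
    then show ?thesis by blast
  next
    case True
    define n where "n = (LEAST n. a n \<noteq> 0 \<or> b n \<noteq> 0)"
    have n: "a n \<noteq> 0 \<or> b n \<noteq> 0"
      unfolding n_def by (rule LeastI_ex[OF True])
    have least: "a m = 0" "b m = 0" if "m < n" for m
      using not_less_Least that unfolding n_def by blast+
    have top: "fourier_coeff (twisted_symbol \<phi>) k = 0 \<and> fourier_coeff (twisted_symbol \<psi>) k = 0"
      if "k > - int n" for k
    proof (cases "k \<ge> 0")
      case True
      then show ?thesis
        using fourier_coeff_twisted_symbol \<phi> \<psi> \<phi>L2 \<psi>L2 by simp
    next
      case False
      then show ?thesis using least[of "nat (- k)"] that by (simp add: a_def b_def)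
    qed
    have "n > 0"
      using n fourier_coeff_twisted_symbol[OF \<phi>(2) \<phi>L2, of 0]
        fourier_coeff_twisted_symbol[OF \<psi>(2) \<psi>L2, of 0] by (cases n) (auto simp: a_def b_def)
    define e :: "complex \<Rightarrow> complex" where "e = (\<lambda>z. z powi (- int n))"
    have e: "e \<in> K_perp \<theta>" unfolding e_def by (rule powi_K_perp) (use \<open>n > 0\<close> in simp)
    have image: "AE z in circle. dual_trunc_hankel \<theta> \<phi> e z = a n * \<theta> z"
      "AE z in circle. dual_trunc_hankel \<theta> \<psi> e z = b n * \<theta> z"
      unfolding e_def a_def b_def
      by (rule dual_trunc_hankel_powi; use \<phi> \<psi> \<open>n > 0\<close> top in simp)+
    have L2: "dual_trunc_hankel \<theta> \<phi> e \<in> L2" "dual_trunc_hankel \<theta> \<psi> e \<in> L2"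
      by (intro K_perp_L2[OF dual_trunc_hankel_K_perp] \<phi> \<psi> K_perp_L2[OF e])+
    have "AE z in circle. dual_trunc_hankel \<theta> \<phi> (dual_trunc_hankel \<theta> \<psi> e) z =
        dual_trunc_hankel \<theta> \<psi> (dual_trunc_hankel \<theta> \<phi> e) z"
      using comm e by (simp add: op_eq_on_def circle_eq_def)
    with dual_trunc_hankel_theta[OF \<phi> L2(2) image(2)] dual_trunc_hankel_theta[OF \<psi> L2(1) image(1)]
      theta_norm
    have "AE z in circle. b n * flip \<phi> z = a n * flip \<psi> z"
    proof eventually_elim
      case (elim z)
      then have "cnj (\<theta> z) \<noteq> 0" by auto
      moreover have "b n * twisted_symbol \<phi> z = a n * twisted_symbol \<psi> z"
        using elim by simp
      ultimately show ?case by (simp add: twisted_symbol_def mult.left_commute[of _ "cnj (\<theta> z)"])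
    qed
    from AE_circle_cnj[OF this] have dep: "AE z in circle. b n * \<phi> z = a n * \<psi> z"
      by (simp add: flip_def)
    show ?thesis
    proof (cases "b n = 0")
      case False
      from dep have "AE z in circle. \<phi> z = a n / b n * \<psi> z"
        by eventually_elim (use False in \<open>simp add: field_simps\<close>)
      then show ?thesis by blast
    next
      case True
      then have "a n \<noteq> 0" using n by simp
      from dep have "AE z in circle. \<psi> z = b n / a n * \<phi> z"
        by eventually_elim (use \<open>a n \<noteq> 0\<close> in \<open>simp add: field_simps\<close>)
      then show ?thesis by blast
    qed
  qed
qed

end

theorem theorem4p8:
  fixes \<theta> \<phi> \<psi> :: "complex \<Rightarrow> complex"
  assumes "inner_function \<theta>"
    and "circle_eq (star \<theta>) \<theta>"
    and "fourier_coeff \<theta> 0 = 0"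
    and "\<phi> \<in> Linf \<inter> Z_space \<theta>"
    and "\<psi> \<in> Linf \<inter> Z_space \<theta>"
  shows "op_eq_on (K_perp \<theta>)
           (dual_trunc_hankel \<theta> \<phi> \<circ> dual_trunc_hankel \<theta> \<psi>)
           (dual_trunc_hankel \<theta> \<psi> \<circ> dual_trunc_hankel \<theta> \<phi>)
     \<longleftrightarrow> (\<exists>c. op_eq_on (K_perp \<theta>) (dual_trunc_hankel \<theta> \<phi>)
              (op_scale c (dual_trunc_hankel \<theta> \<psi>)))
       \<or> (\<exists>c. op_eq_on (K_perp \<theta>) (dual_trunc_hankel \<theta> \<psi>)
              (op_scale c (dual_trunc_hankel \<theta> \<phi>)))"
    (is "?comm \<longleftrightarrow> ?scalar")
proof
  interpret symmetric_inner_fun \<theta>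
    using assms by unfold_locales
  have \<phi>: "\<phi> \<in> Linf" "\<phi> \<in> Z_space \<theta>" and \<psi>: "\<psi> \<in> Linf" "\<psi> \<in> Z_space \<theta>"
    using assms by auto
  show ?scalar if ?comm
    using symbols_dependent_if_commute[OF \<phi> \<psi> that]
      op_scale_if_symbol_scale[OF \<phi>(1) \<psi>(1)] op_scale_if_symbol_scale[OF \<psi>(1) \<phi>(1)]
    by blast
  show ?comm if ?scalar
    unfolding op_eq_on_def circle_eq_def comp_def
  proof
    fix h assume h: "h \<in> K_perp \<theta>"
    from that show "AE z in circle. dual_trunc_hankel \<theta> \<phi> (dual_trunc_hankel \<theta> \<psi> h) z =
        dual_trunc_hankel \<theta> \<psi> (dual_trunc_hankel \<theta> \<phi> h) z"
    proof
      assume "\<exists>c. op_eq_on (K_perp \<theta>) (dual_trunc_hankel \<theta> \<phi>) (op_scale c (dual_trunc_hankel \<theta> \<psi>))"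
      then show ?thesis
        using dual_trunc_hankel_commute_if_scalar[OF \<phi>(1) \<psi>(1) _ h] by blast
    next
      assume "\<exists>c. op_eq_on (K_perp \<theta>) (dual_trunc_hankel \<theta> \<psi>) (op_scale c (dual_trunc_hankel \<theta> \<phi>))"
      then obtain c where "op_eq_on (K_perp \<theta>) (dual_trunc_hankel \<theta> \<psi>) (op_scale c (dual_trunc_hankel \<theta> \<phi>))"
        by blast
      from dual_trunc_hankel_commute_if_scalar[OF \<psi>(1) \<phi>(1) this h]
      show ?thesis by eventually_elim simp
    qed
  qed
qed

end
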